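(* Let $R$ be a ring and $G$ a group, and let $RG$ be the group ring of $G$ over $R$. Then the following two conditions hold: (1) If $RG$ is a generalized $\sqrt{J}$-fine ring, then $R$ is a generalized $\sqrt{J}$-fine ring and $G$ is a $p$-group with $p\in J(R)$ (for some prime number $p$). (2) The converse of (1) holds if $G$ is a locally finite group; that is, if $G$ is locally finite, $R$ is a generalized $\sqrt{J}$-fine ring, and $G$ is a $p$-group with $p\in J(R)$ (for some prime number $p$), then $RG$ is a generalized $\sqrt{J}$-fine ring.
   Context: Rings are associative with identity, not necessarily commutative. For a ring $R$, $U(R)$ is the group of units, $J(R)$ the Jacobson radical, and $\sqrt{J(R)}=\{x\in R : x^m\in J(R)\text{ for some } m\ge 1\}$. A ring $R$ is called generalized $\sqrt{J}$-fine if every $r\in R\setminus J(R)$ can be written as $r=u+a$ with $u\in U(R)$ and $a\in\sqrt{J(R)}$. A group $G$ is a $p$-group if the order of every element of $G$ is a power of the prime number $p$; $G$ is locally finite if every finitely generated subgroup of $G$ is finite. The condition $p\in J(R)$ means $p\cdot 1_R\in J(R)$.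
   Formalization: In (1), "G is a p-group" is claimed only for R nonzero (R = 0, G = Z is a counterexample) and "p in J(R)" only if moreover G is nontrivial (R = Q with G trivial is a counterexample); that R is generalized √J-fine is claimed always. *)

theory Defs
  imports "HOL-Algebra.Generated_Groups" "HOL-Algebra.Multiplicative_Group" "HOL-Computational_Algebra.Primes"
begin

text \<open>HOL-Algebra has only two-sided ideals; over a noncommutative ring the Jacobson radical
  is the intersection of the maximal left ideals. The zero ring has no maximal left ideal, and
  the empty intersection is then the whole carrier.\<close>

definition left_ideal :: "'a set \<Rightarrow> ('a, 'm) ring_scheme \<Rightarrow> bool" where
  "left_ideal I R \<longleftrightarrow>
     additive_subgroup I R \<and> (\<forall>a\<in>I. \<forall>x\<in>carrier R. x \<otimes>\<^bsub>R\<^esub> a \<in> I)"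

definition maximal_left_ideal :: "'a set \<Rightarrow> ('a, 'm) ring_scheme \<Rightarrow> bool" where
  "maximal_left_ideal M R \<longleftrightarrow>
     left_ideal M R \<and> M \<noteq> carrier R \<and>
     (\<forall>I. left_ideal I R \<and> M \<subseteq> I \<longrightarrow> I = M \<or> I = carrier R)"

definition jacobson_radical :: "('a, 'm) ring_scheme \<Rightarrow> 'a set" where
  "jacobson_radical R = {x \<in> carrier R. \<forall>M. maximal_left_ideal M R \<longrightarrow> x \<in> M}"

definition sqrt_jacobson :: "('a, 'm) ring_scheme \<Rightarrow> 'a set" where
  "sqrt_jacobson R =
     {x \<in> carrier R. \<exists>m::nat. m \<ge> 1 \<and> x [^]\<^bsub>R\<^esub> m \<in> jacobson_radical R}"

definition generalized_sqrtJ_fine :: "('a, 'm) ring_scheme \<Rightarrow> bool" where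
  "generalized_sqrtJ_fine R \<longleftrightarrow>
     (\<forall>r \<in> carrier R - jacobson_radical R.
        \<exists>u \<in> Units R. \<exists>a \<in> sqrt_jacobson R. r = u \<oplus>\<^bsub>R\<^esub> a)"

text \<open>An element of infinite order has \<open>group.ord G g = 0\<close>, which is not a power of a prime.\<close>

definition p_group :: "nat \<Rightarrow> ('g, 'n) monoid_scheme \<Rightarrow> bool" where
  "p_group p G \<longleftrightarrow> (\<forall>g \<in> carrier G. \<exists>k::nat. group.ord G g = p ^ k)"

definition locally_finite_group :: "('g, 'n) monoid_scheme \<Rightarrow> bool" where
  "locally_finite_group G \<longleftrightarrow>
     (\<forall>S. S \<subseteq> carrier G \<and> finite S \<longrightarrow> finite (generate G S))"

text \<open>The group ring \<open>RG\<close>: finitely supported functions from \<open>G\<close> to \<open>R\<close> (extensional outside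
  \<open>carrier G\<close>, so that equality is equality on \<open>G\<close>), where \<open>f\<close> stands for the formal sum of
  the \<open>f g \<cdot> g\<close>. The convolution sum at \<open>x\<close> ranges over the support of the left factor because
  the sum over an infinite set is not meaningful for \<open>finsum\<close>.\<close>

definition group_ring :: "('r, 'm) ring_scheme \<Rightarrow> ('g, 'n) monoid_scheme \<Rightarrow> ('g \<Rightarrow> 'r) ring" where
  "group_ring R G =
     \<lparr> carrier = {f \<in> carrier G \<rightarrow>\<^sub>E carrier R. finite {g \<in> carrier G. f g \<noteq> \<zero>\<^bsub>R\<^esub>}},
       monoid.mult = (\<lambda>f h. \<lambda>x \<in> carrier G.
         \<Oplus>\<^bsub>R\<^esub> y \<in> {y \<in> carrier G. f y \<noteq> \<zero>\<^bsub>R\<^esub>}. f y \<otimes>\<^bsub>R\<^esub> h (inv\<^bsub>G\<^esub> y \<otimes>\<^bsub>G\<^esub> x)),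
       one = (\<lambda>x \<in> carrier G. if x = \<one>\<^bsub>G\<^esub> then \<one>\<^bsub>R\<^esub> else \<zero>\<^bsub>R\<^esub>),
       zero = (\<lambda>x \<in> carrier G. \<zero>\<^bsub>R\<^esub>),
       add = (\<lambda>f h. \<lambda>x \<in> carrier G. f x \<oplus>\<^bsub>R\<^esub> h x) \<rparr>"

end

theory Submission
  imports Defs "HOL-Algebra.Group_Action" "HOL-Algebra.Sylow"
begin

text \<open>Let \<open>\<epsilon>\<close> be the augmentation \<open>RG \<rightarrow> R\<close>. If \<open>RG\<close> is fine in the generalized sense, write a
  putative element \<open>x\<close> of the kernel of \<open>\<epsilon>\<close> outside the radical as \<open>u + a\<close>: then \<open>\<epsilon>(u) = -\<epsilon>(a)\<close>
  is a unit with a power in the radical, which is impossible. So every \<open>g - 1\<close> lies in the radical of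
  \<open>RG\<close>, and this forces \<open>g\<close> to have finite order and every prime divisor of that order to lie in the
  radical of \<open>R\<close>; two different primes cannot both lie there. Conversely, for a locally finite
  \<open>p\<close>-group with \<open>p\<close> in the radical of \<open>R\<close>, the preimage of the radical of \<open>R\<close> under \<open>\<epsilon>\<close> is
  contained in the radical of \<open>RG\<close>, so a decomposition of \<open>\<epsilon>(f)\<close> lifts to one of \<open>f\<close>. For a finite
  group this inclusion says that \<open>G\<close> and the radical of \<open>R\<close> act trivially on a simple left
  \<open>RG\<close>-module, which follows from Nakayama's lemma and the fixed point property of \<open>p\<close>-groups.\<close>

section \<open>Jacobson radical\<close>

text \<open>Two obstacles shape the argument. \<open>R\<close> is noncommutative, so the radical is
  tested by one-sided inverses: \<open>x\<close> is radical iff every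
  \<open>\<one> \<ominus> y \<otimes> x\<close> has a left inverse. This elementwise test carries
  the radical along surjections, and from finite subgroups up to a locally finite group, since each
  test involves a single finitely supported element. Moreover \<open>R\<close> may be infinite, so
  \<open>RG\<close> modulo a maximal left ideal \<open>M\<close> cannot be counted; only integral
  combinations of group elements modulo \<open>M\<close> are counted, and for finite
  \<open>G\<close> there are finitely many of them because \<open>p\<close> acts as zero there. In
  the necessity part primes enter through a dichotomy: integers are central, and in a fine ring a
  central element is either radical or a unit. If a prime divisor \<open>q\<close> of the order of
  \<open>g\<close> were a unit, a power of \<open>g\<close> of order \<open>q\<close> would be a
  \<open>q\<close>-th root of unity congruent to 1 modulo the radical, and 1 is the only such root
  when \<open>q\<close> is invertible.\<close>

context ring
begin

section \<open>Left ideals and maximal left ideals\<close>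

lemma left_idealI:
  assumes "I \<subseteq> carrier R" "\<zero> \<in> I"
    and "\<And>a b. a \<in> I \<Longrightarrow> b \<in> I \<Longrightarrow> a \<oplus> b \<in> I"
    and "\<And>x a. x \<in> carrier R \<Longrightarrow> a \<in> I \<Longrightarrow> x \<otimes> a \<in> I"
  shows "left_ideal I R"
proof -
  have "\<ominus> a \<in> I" if "a \<in> I" for a
    using assms(1) assms(4)[of "\<ominus> \<one>" a] that by (auto simp: l_minus)
  then have "subgroup I (add_monoid R)"
    using assms by (intro add.subgroupI) (auto simp flip: a_inv_def)
  then show ?thesis
    using assms(4) by (auto simp: left_ideal_def intro: additive_subgroupI)
qed

lemma left_idealD:
  assumes "left_ideal I R"
  shows "I \<subseteq> carrier R" "\<zero> \<in> I"
    and "\<And>a b. a \<in> I \<Longrightarrow> b \<in> I \<Longrightarrow> a \<oplus> b \<in> I"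
    and "\<And>a b. a \<in> I \<Longrightarrow> b \<in> I \<Longrightarrow> a \<ominus> b \<in> I"
    and "\<And>a. a \<in> I \<Longrightarrow> \<ominus> a \<in> I"
    and "\<And>x a. x \<in> carrier R \<Longrightarrow> a \<in> I \<Longrightarrow> x \<otimes> a \<in> I"
proof -
  interpret additive_subgroup I R
    using assms by (simp add: left_ideal_def)
  show sub: "I \<subseteq> carrier R" "\<zero> \<in> I"
    using a_subset zero_closed by auto
  show add: "\<And>a b. a \<in> I \<Longrightarrow> b \<in> I \<Longrightarrow> a \<oplus> b \<in> I"
    using a_closed by auto
  show mult: "\<And>x a. x \<in> carrier R \<Longrightarrow> a \<in> I \<Longrightarrow> x \<otimes> a \<in> I"
    using assms by (simp add: left_ideal_def)
  show neg: "\<ominus> a \<in> I" if "a \<in> I" for a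
    using mult[of "\<ominus> \<one>" a] that sub by (auto simp: l_minus)
  show "\<And>a b. a \<in> I \<Longrightarrow> b \<in> I \<Longrightarrow> a \<ominus> b \<in> I"
    unfolding a_minus_def by (intro add neg)
qed

lemma left_ideal_eq_carrier:
  assumes "left_ideal I R" "\<one> \<in> I"
  shows "I = carrier R"
  using left_idealD(1,6)[OF assms(1)] assms(2) by (metis r_one subsetI subset_antisym)

text \<open>Zorn's lemma, with properness phrased as \<open>\<one> \<notin> L\<close> because in
  this form it passes at once to unions of chains.\<close>

lemma maximal_left_ideal_exists:
  assumes "left_ideal I R" "\<one> \<notin> I"
  shows "\<exists>M. maximal_left_ideal M R \<and> I \<subseteq> M"
proof -
  define \<A> where "\<A> = {L. left_ideal L R \<and> \<one> \<notin> L \<and> I \<subseteq> L}"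
  have "\<exists>M\<in>\<A>. \<forall>X\<in>\<A>. M \<subseteq> X \<longrightarrow> X = M"
  proof (rule subset_Zorn_nonempty)
    show "\<A> \<noteq> {}"
      using assms by (auto simp: \<A>_def)
    fix \<C>
    assume "\<C> \<noteq> {}" and "subset.chain \<A> \<C>"
    then have sub: "\<C> \<subseteq> \<A>" and total: "\<And>X Y. X \<in> \<C> \<Longrightarrow> Y \<in> \<C> \<Longrightarrow> X \<subseteq> Y \<or> Y \<subseteq> X"
      by (auto simp: subset.chain_def)
    have li: "left_ideal L R" if "L \<in> \<C>" for L
      using sub that by (auto simp: \<A>_def)
    have "left_ideal (\<Union>\<C>) R"
    proof (rule left_idealI)
      show "\<Union>\<C> \<subseteq> carrier R"
        using left_idealD(1)[OF li] by blast
      show "\<zero> \<in> \<Union>\<C>"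
        using left_idealD(2)[OF li] \<open>\<C> \<noteq> {}\<close> by blast
      show "a \<oplus> b \<in> \<Union>\<C>" if ab: "a \<in> \<Union>\<C>" "b \<in> \<Union>\<C>" for a b
      proof -
        obtain X Y where "X \<in> \<C>" "Y \<in> \<C>" "a \<in> X" "b \<in> Y"
          using ab by blast
        then obtain Z where "Z \<in> \<C>" "a \<in> Z" "b \<in> Z"
          using total by blast
        then show ?thesis
          using left_idealD(3)[OF li] by blast
      qed
      show "x \<otimes> a \<in> \<Union>\<C>" if "x \<in> carrier R" "a \<in> \<Union>\<C>" for x a
        using that left_idealD(6)[OF li] by blast
    qed
    then show "\<Union>\<C> \<in> \<A>"
      using sub \<open>\<C> \<noteq> {}\<close> by (auto simp: \<A>_def)
  qed
  then obtain M where M: "M \<in> \<A>" and max: "\<And>X. X \<in> \<A> \<Longrightarrow> M \<subseteq> X \<Longrightarrow> X = M"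
    by blast
  have "maximal_left_ideal M R"
    unfolding maximal_left_ideal_def
  proof (intro conjI allI impI)
    show "left_ideal M R" "M \<noteq> carrier R"
      using M by (auto simp: \<A>_def)
    fix L
    assume L: "left_ideal L R \<and> M \<subseteq> L"
    show "L = M \<or> L = carrier R"
    proof (cases "\<one> \<in> L")
      case True
      then show ?thesis
        using L left_ideal_eq_carrier by blast
    next
      case False
      then have "L \<in> \<A>"
        using L M by (auto simp: \<A>_def)
      then show ?thesis
        using L max by blast
    qed
  qed
  then show ?thesis
    using M by (auto simp: \<A>_def)
qed

lemma maximal_left_idealD:
  assumes "maximal_left_ideal M R"
  shows "left_ideal M R" "\<one> \<notin> M"
    and "\<And>L. left_ideal L R \<Longrightarrow> M \<subseteq> L \<Longrightarrow> L \<noteq> M \<Longrightarrow> L = carrier R"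
proof -
  show "left_ideal M R"
    using assms by (simp add: maximal_left_ideal_def)
  then show "\<one> \<notin> M"
    using assms left_ideal_eq_carrier unfolding maximal_left_ideal_def by blast
  show "\<And>L. left_ideal L R \<Longrightarrow> M \<subseteq> L \<Longrightarrow> L \<noteq> M \<Longrightarrow> L = carrier R"
    using assms unfolding maximal_left_ideal_def by blast
qed

lemma left_ideal_sum:
  assumes I: "left_ideal I R" and L: "left_ideal L R"
  shows "left_ideal {a \<oplus> b | a b. a \<in> I \<and> b \<in> L} R"
proof (rule left_idealI)
  note closed = subsetD[OF left_idealD(1)[OF I]] subsetD[OF left_idealD(1)[OF L]]
  show "{a \<oplus> b | a b. a \<in> I \<and> b \<in> L} \<subseteq> carrier R"
    using closed by auto
  show "\<zero> \<in> {a \<oplus> b | a b. a \<in> I \<and> b \<in> L}"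
    using left_idealD(2)[OF I] left_idealD(2)[OF L] by force
  show "x \<oplus> y \<in> {a \<oplus> b | a b. a \<in> I \<and> b \<in> L}"
    if xy: "x \<in> {a \<oplus> b | a b. a \<in> I \<and> b \<in> L}" "y \<in> {a \<oplus> b | a b. a \<in> I \<and> b \<in> L}" for x y
  proof -
    obtain a b c d where "x = a \<oplus> b" "y = c \<oplus> d" "a \<in> I" "c \<in> I" "b \<in> L" "d \<in> L"
      using xy by blast
    moreover from this have "x \<oplus> y = (a \<oplus> c) \<oplus> (b \<oplus> d)"
      using closed by (simp add: a_ac)
    ultimately show ?thesis
      using left_idealD(3)[OF I] left_idealD(3)[OF L] by blast
  qed
  show "x \<otimes> y \<in> {a \<oplus> b | a b. a \<in> I \<and> b \<in> L}"
    if xy: "x \<in> carrier R" "y \<in> {a \<oplus> b | a b. a \<in> I \<and> b \<in> L}" for x y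
  proof -
    obtain a b where "y = a \<oplus> b" "a \<in> I" "b \<in> L"
      using xy by auto
    moreover from this have "x \<otimes> y = x \<otimes> a \<oplus> x \<otimes> b"
      using closed xy by (simp add: r_distr)
    ultimately show ?thesis
      using left_idealD(6)[OF I] left_idealD(6)[OF L] xy by blast
  qed
qed

lemma left_ideal_principal:
  assumes "a \<in> carrier R"
  shows "left_ideal {x \<otimes> a | x. x \<in> carrier R} R"
proof (rule left_idealI)
  show "{x \<otimes> a | x. x \<in> carrier R} \<subseteq> carrier R" "\<zero> \<in> {x \<otimes> a | x. x \<in> carrier R}"
    using assms by (auto intro!: exI[of _ \<zero>])
  show "x \<oplus> y \<in> {x \<otimes> a | x. x \<in> carrier R}"
    if "x \<in> {x \<otimes> a | x. x \<in> carrier R}" "y \<in> {x \<otimes> a | x. x \<in> carrier R}" for x y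
    using that assms by (auto simp flip: l_distr)
  show "x \<otimes> y \<in> {x \<otimes> a | x. x \<in> carrier R}"
    if "x \<in> carrier R" "y \<in> {x \<otimes> a | x. x \<in> carrier R}" for x y
    using that assms by (auto simp flip: m_assoc)
qed

text \<open>\<open>M + L\<close> strictly contains \<open>M\<close>, so it is the whole ring. This
  replaces the simplicity of the module \<open>R/M\<close>: quotient modules are never formed, and
  all module arguments are congruences modulo \<open>M\<close>.\<close>

lemma maximal_left_ideal_sum:
  assumes M: "maximal_left_ideal M R" and L: "left_ideal L R" "\<not> L \<subseteq> M" and x: "x \<in> carrier R"
  obtains m l where "m \<in> M" "l \<in> L" "x = m \<oplus> l"
proof -
  note lM = maximal_left_idealD(1)[OF M]
  let ?S = "{a \<oplus> b | a b. a \<in> M \<and> b \<in> L}"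
  have "M \<subseteq> ?S"
    using left_idealD(1)[OF lM] left_idealD(2)[OF L(1)] by force
  moreover have "L \<subseteq> ?S"
    using left_idealD(1)[OF L(1)] left_idealD(2)[OF lM] by force
  then have "?S \<noteq> M"
    using L(2) by metis
  ultimately have "?S = carrier R"
    by (rule maximal_left_idealD(3)[OF M left_ideal_sum[OF lM L(1)]])
  then show ?thesis
    using that x by blast
qed

section \<open>The radical and one-sided inverses\<close>

lemma left_ideal_jacobson_radical: "left_ideal (jacobson_radical R) R"
proof -
  note D = left_idealD[OF maximal_left_idealD(1)]
  show ?thesis
    by (rule left_idealI) (auto simp: jacobson_radical_def intro: D)
qed

lemmas jacobson_radicalD = left_idealD[OF left_ideal_jacobson_radical]

text \<open>Otherwise the left ideal generated by \<open>\<one> \<ominus> j\<close> lies in a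
  maximal one, which also contains \<open>j\<close> and therefore 1.\<close>

lemma one_minus_jacobson_left_inverse:
  assumes j: "j \<in> jacobson_radical R"
  shows "\<exists>u \<in> carrier R. u \<otimes> (\<one> \<ominus> j) = \<one>"
proof (rule ccontr)
  assume not: "\<not> ?thesis"
  have jc: "j \<in> carrier R"
    using j jacobson_radicalD(1) by blast
  let ?L = "{x \<otimes> (\<one> \<ominus> j) | x. x \<in> carrier R}"
  have "\<one> \<notin> ?L"
    using not by (auto dest: sym)
  then obtain M where M: "maximal_left_ideal M R" "?L \<subseteq> M"
    using maximal_left_ideal_exists[OF left_ideal_principal[of "\<one> \<ominus> j"]] jc by auto
  have "j \<in> M"
    using M j by (simp add: jacobson_radical_def)
  moreover have "\<one> \<otimes> (\<one> \<ominus> j) \<in> M"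
    using M by blast
  ultimately have "(\<one> \<ominus> j) \<oplus> j \<in> M"
    using left_idealD(3)[OF maximal_left_idealD(1)[OF M(1)]] jc by simp
  then show False
    using maximal_left_idealD(2)[OF M(1)] jc by (simp add: a_minus_def a_assoc l_neg)
qed

lemma Units_intro:
  assumes "x \<in> carrier R" "y \<in> carrier R" "z \<in> carrier R" "y \<otimes> x = \<one>" "x \<otimes> z = \<one>"
  shows "x \<in> Units R"
proof -
  have "y = y \<otimes> (x \<otimes> z)"
    using assms by simp
  also have "\<dots> = z"
    using assms by (metis m_assoc l_one)
  finally show ?thesis
    using assms by (auto simp: Units_def)
qed

lemma one_minus_jacobson_Units:
  assumes j: "j \<in> jacobson_radical R"
  shows "\<one> \<ominus> j \<in> Units R"
proof -
  have jc: "j \<in> carrier R"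
    using j jacobson_radicalD(1) by blast
  obtain u where u: "u \<in> carrier R" "u \<otimes> (\<one> \<ominus> j) = \<one>"
    using one_minus_jacobson_left_inverse[OF j] by blast
  \<comment> \<open>The left inverse \<open>u\<close> again has the form 1 minus a radical element,
    so it has a left inverse of its own. Thus \<open>u\<close> is invertible on both sides and
    \<open>\<one> \<ominus> j\<close> is its inverse.\<close>
  have "u = \<one> \<ominus> (\<ominus> (u \<otimes> j))"
  proof -
    have "u = u \<otimes> (\<one> \<ominus> j) \<oplus> u \<otimes> j"
      using u(1) jc by (simp add: a_minus_def r_distr r_minus a_assoc l_neg)
    then show ?thesis
      using u jc by (simp add: a_minus_def)
  qed
  moreover have "\<ominus> (u \<otimes> j) \<in> jacobson_radical R"
    using u(1) j by (intro jacobson_radicalD)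
  ultimately obtain v where v: "v \<in> carrier R" "v \<otimes> u = \<one>"
    using one_minus_jacobson_left_inverse by metis
  have "u \<in> Units R"
    using Units_intro[OF u(1) v(1) _ v(2) u(2)] jc by simp
  moreover have "\<one> \<ominus> j = inv u"
    using inv_char Units_inv_closed calculation u v jc
    by (metis Units_l_inv Units_r_inv inv_unique minus_closed one_closed)
  ultimately show ?thesis
    by simp
qed

text \<open>If \<open>x\<close> avoided a maximal \<open>M\<close>, then \<open>M\<close> and the
  multiples of \<open>x\<close> would span the ring, so some
  \<open>\<one> \<ominus> y \<otimes> x\<close> would lie in \<open>M\<close> and could not have a
  left inverse. The inverse may depend on \<open>y\<close>, which is what the locally finite case
  exploits.\<close>

lemma mem_jacobson_radicalI:
  assumes x: "x \<in> carrier R"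
    and inv: "\<And>y. y \<in> carrier R \<Longrightarrow> \<exists>u \<in> carrier R. u \<otimes> (\<one> \<ominus> y \<otimes> x) = \<one>"
  shows "x \<in> jacobson_radical R"
proof -
  have "x \<in> M" if M: "maximal_left_ideal M R" for M
  proof (rule ccontr)
    assume "x \<notin> M"
    moreover have "x \<in> {y \<otimes> x | y. y \<in> carrier R}"
      using x by (force intro: exI[of _ \<one>])
    ultimately obtain m y where m: "m \<in> M" "y \<in> carrier R" "\<one> = m \<oplus> y \<otimes> x"
      using maximal_left_ideal_sum[OF M left_ideal_principal[OF x] _ one_closed] by blast
    note lM = maximal_left_idealD(1)[OF M]
    have mc: "m \<in> carrier R"
      using left_idealD(1)[OF lM] m by blast
    have "\<one> \<ominus> y \<otimes> x = m"
      using m mc x by (simp add: a_minus_def a_assoc r_neg)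
    then obtain u where "u \<in> carrier R" "u \<otimes> m = \<one>"
      using inv[OF m(2)] by auto
    then show False
      using left_idealD(6)[OF lM] m(1) maximal_left_idealD(2)[OF M] by metis
  qed
  then show ?thesis
    using x by (simp add: jacobson_radical_def)
qed

text \<open>The radical is built from left ideals, so closure on the right needs an argument: left
  inverses of \<open>1 - ba\<close> yield left inverses of \<open>1 - ab\<close>.\<close>

lemma jacobson_radical_r_mult:
  assumes x: "x \<in> jacobson_radical R" and r: "r \<in> carrier R"
  shows "x \<otimes> r \<in> jacobson_radical R"
proof (rule mem_jacobson_radicalI)
  have xc: "x \<in> carrier R"
    using x jacobson_radicalD(1) by blast
  then show "x \<otimes> r \<in> carrier R"
    using r by simp
  fix y
  assume y: "y \<in> carrier R"
  have "r \<otimes> y \<otimes> x \<in> jacobson_radical R"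
    using r y x by (intro jacobson_radicalD) auto
  then obtain c where c: "c \<in> carrier R" "c \<otimes> (\<one> \<ominus> r \<otimes> y \<otimes> x) = \<one>"
    using one_minus_jacobson_left_inverse by blast
  let ?z = "y \<otimes> x"
  \<comment> \<open>With \<open>a = y \<otimes> x\<close> and \<open>b = r\<close>, this is the
    identity that \<open>1 + a c b\<close> inverts \<open>1 - a b\<close> on the left whenever
    \<open>c\<close> inverts \<open>1 - b a\<close> on the left.\<close>
  have "(\<one> \<oplus> ?z \<otimes> c \<otimes> r) \<otimes> (\<one> \<ominus> y \<otimes> (x \<otimes> r)) =
    \<one> \<ominus> ?z \<otimes> r \<oplus> ?z \<otimes> (c \<otimes> (\<one> \<ominus> r \<otimes> y \<otimes> x)) \<otimes> r"
    using r y xc c(1)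
    by (simp add: a_minus_def l_distr r_distr m_assoc l_minus r_minus minus_add a_ac)
  also have "\<dots> = \<one>"
    using r y xc c by (simp add: a_minus_def a_assoc l_neg)
  finally show "\<exists>u \<in> carrier R. u \<otimes> (\<one> \<ominus> y \<otimes> (x \<otimes> r)) = \<one>"
    using r y xc c by (intro bexI[of _ "\<one> \<oplus> ?z \<otimes> c \<otimes> r"]) auto
qed

lemma unit_plus_jacobson:
  assumes u: "u \<in> Units R" and j: "j \<in> jacobson_radical R"
  shows "u \<oplus> j \<in> Units R"
proof -
  have jc: "j \<in> carrier R"
    using j jacobson_radicalD(1) by blast
  have "\<ominus> (inv u \<otimes> j) \<in> jacobson_radical R"
    using u j by (intro jacobson_radicalD) auto
  then have "u \<otimes> (\<one> \<ominus> (\<ominus> (inv u \<otimes> j))) \<in> Units R"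
    using one_minus_jacobson_Units u by blast
  moreover have "u \<otimes> (\<one> \<ominus> (\<ominus> (inv u \<otimes> j))) = u \<oplus> j"
    using Units_closed[OF u] u jc by (simp add: a_minus_def r_distr flip: m_assoc)
  ultimately show ?thesis
    by simp
qed

lemma unit_in_jacobson_trivial:
  assumes u: "u \<in> Units R" and j: "u \<in> jacobson_radical R"
  shows "\<one> = \<zero>"
proof -
  have "u \<oplus> \<ominus> u \<in> Units R"
    using unit_plus_jacobson[OF u] j jacobson_radicalD(5) by blast
  then have "\<zero> \<in> Units R"
    using Units_closed[OF u] by (simp add: r_neg)
  then show ?thesis
    using Units_l_inv[of \<zero>] Units_inv_closed[of \<zero>] by simp
qed

lemma Units_a_inv: "u \<in> Units R \<Longrightarrow> \<ominus> u \<in> Units R"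
  using Units_m_closed[OF Units_minus_one_closed, of u] by (simp add: l_minus Units_closed)

lemma unit_in_sqrt_jacobson_trivial:
  assumes "u \<in> Units R" "u \<in> sqrt_jacobson R"
  shows "\<one> = \<zero>"
  using assms unit_in_jacobson_trivial Units_pow_closed by (auto simp: sqrt_jacobson_def)

text \<open>Write \<open>c = u + a\<close>. Modulo multiples of the central element
  \<open>c\<close>, the unit \<open>u\<close> equals \<open>-a\<close>, so some power of
  \<open>u\<close> is radical up to a multiple of \<open>c\<close>. Removing the radical part leaves
  a unit of the form \<open>c \<otimes> d\<close>, and centrality makes the resulting right inverse
  of \<open>c\<close> two-sided.\<close>

lemma central_unit_of_fine:
  assumes fine: "generalized_sqrtJ_fine R"
    and c: "c \<in> carrier R" "c \<notin> jacobson_radical R"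
    and central: "\<And>x. x \<in> carrier R \<Longrightarrow> c \<otimes> x = x \<otimes> c"
  shows "c \<in> Units R"
proof -
  obtain u a where u: "u \<in> Units R" and a: "a \<in> sqrt_jacobson R" and eq: "c = u \<oplus> a"
    using fine c unfolding generalized_sqrtJ_fine_def by blast
  then obtain m :: nat where ac: "a \<in> carrier R" and am: "a [^] m \<in> jacobson_radical R"
    by (auto simp: sqrt_jacobson_def)
  have uc: "u \<in> carrier R"
    using u by auto
  \<comment> \<open>The factor \<open>s\<close> is the sign of \<open>(-a)^k\<close>, starting at 1
    and negated at each step.\<close>
  have "\<exists>s \<in> Units R. \<exists>d \<in> carrier R. s \<in> carrier R \<and> u [^] k = s \<otimes> a [^] k \<oplus> c \<otimes> d" for k :: nat
  proof (induction k)
    case 0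
    then show ?case
      using c by (intro bexI[of _ \<one>] bexI[of _ \<zero>]) auto
  next
    case (Suc k)
    then obtain s d where s: "s \<in> Units R" "s \<in> carrier R" "d \<in> carrier R"
      and IH: "u [^] k = s \<otimes> a [^] k \<oplus> c \<otimes> d"
      by blast
    have eu: "u = c \<oplus> \<ominus> a"
      using eq uc ac by (simp add: a_assoc r_neg)
    have "u [^] Suc k = (s \<otimes> a [^] k \<oplus> c \<otimes> d) \<otimes> (c \<oplus> \<ominus> a)"
      using IH eu by simp
    also have "\<dots> = (\<ominus> s) \<otimes> (a [^] k \<otimes> a) \<oplus> (c \<otimes> (s \<otimes> a [^] k \<oplus> d \<otimes> c \<ominus> d \<otimes> a))"
    proof -
      have "s \<otimes> (a [^] k \<otimes> c) = c \<otimes> (s \<otimes> a [^] k)"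
        using s c ac central[of "s \<otimes> a [^] k"] by (simp add: m_assoc)
      then show ?thesis
        using s c ac by (simp add: a_minus_def l_distr r_distr l_minus r_minus m_assoc minus_add a_ac)
    qed
    finally have "u [^] Suc k = (\<ominus> s) \<otimes> a [^] Suc k \<oplus> (c \<otimes> (s \<otimes> a [^] k \<oplus> d \<otimes> c \<ominus> d \<otimes> a))"
      by simp
    moreover have "\<ominus> s \<in> carrier R" "s \<otimes> a [^] k \<oplus> d \<otimes> c \<ominus> d \<otimes> a \<in> carrier R"
      using s c(1) ac by simp_all
    ultimately show ?case
      using Units_a_inv[OF s(1)] by blast
  qed
  then obtain s d where sd: "s \<in> carrier R" "d \<in> carrier R" "u [^] m = s \<otimes> a [^] m \<oplus> c \<otimes> d"
    by blast
  have "u [^] m \<oplus> \<ominus> (s \<otimes> a [^] m) \<in> Units R"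
    using u am sd by (intro unit_plus_jacobson Units_pow_closed jacobson_radicalD)
  moreover have "u [^] m \<oplus> \<ominus> (s \<otimes> a [^] m) = c \<otimes> d"
    unfolding sd(3) using sd(1,2) c ac by (simp add: a_ac r_neg r_neg1 r_neg2)
  ultimately have cd: "c \<otimes> d \<in> Units R"
    by simp
  show ?thesis
  proof (rule Units_intro)
    show "d \<otimes> inv (c \<otimes> d) \<in> carrier R" "c \<otimes> (d \<otimes> inv (c \<otimes> d)) = \<one>"
      using cd sd c by (simp_all flip: m_assoc)
    then show "(d \<otimes> inv (c \<otimes> d)) \<otimes> c = \<one>"
      using central by simp
  qed (use c sd cd in auto)
qed

lemma minus_telescope:
  assumes "a \<in> carrier R" "b \<in> carrier R" "c \<in> carrier R"
  shows "(a \<ominus> b) \<oplus> (c \<ominus> a) = c \<ominus> b"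
proof -
  have "(a \<ominus> b) \<oplus> (c \<ominus> a) = (c \<ominus> a) \<oplus> (a \<ominus> b)"
    using assms by (intro a_comm) auto
  also have "\<dots> = c \<ominus> b"
    using assms by (simp add: a_minus_def a_assoc r_neg1)
  finally show ?thesis .
qed

text \<open>The geometric sum \<open>N\<close> of \<open>x\<close> is congruent to \<open>q\<close> modulo the radical, hence invertible,
  and it annihilates \<open>x - 1\<close>.\<close>

lemma root_of_unity_in_one_plus_jacobson:
  assumes x: "x \<in> carrier R" "x \<ominus> \<one> \<in> jacobson_radical R" and q: "x [^] q = \<one>"
    and unit: "[(q::nat)] \<cdot> \<one> \<in> Units R"
  shows "x = \<one>"
proof -
  \<comment> \<open>Here \<open>n\<close> is \<open>1 + x + ... + x^(k-1)\<close>. The last conjunct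
    says that the next summand \<open>x^k\<close> is congruent to 1, so that each step raises the
    residue of \<open>n\<close> by exactly 1.\<close>
  have "\<exists>n \<in> carrier R. n \<ominus> [k] \<cdot> \<one> \<in> jacobson_radical R \<and> n \<otimes> (x \<ominus> \<one>) = x [^] k \<ominus> \<one>
      \<and> x [^] k \<ominus> \<one> \<in> jacobson_radical R" for k :: nat
  proof (induction k)
    case 0
    then show ?case
      using x jacobson_radicalD(2) by (intro bexI[of _ \<zero>]) (auto simp: a_minus_def r_neg)
  next
    case (Suc k)
    then obtain n where n: "n \<in> carrier R" "n \<ominus> [k] \<cdot> \<one> \<in> jacobson_radical R"
      "n \<otimes> (x \<ominus> \<one>) = x [^] k \<ominus> \<one>" "x [^] k \<ominus> \<one> \<in> jacobson_radical R"
      by blast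
    have c: "[k] \<cdot> \<one> \<in> carrier R" "x [^] k \<in> carrier R"
      using x by auto
    have "n \<oplus> x [^] k \<ominus> [Suc k] \<cdot> \<one> = (n \<ominus> [k] \<cdot> \<one>) \<oplus> (x [^] k \<ominus> \<one>)"
      using n(1) c by (simp add: a_minus_def minus_add a_ac)
    then have 1: "n \<oplus> x [^] k \<ominus> [Suc k] \<cdot> \<one> \<in> jacobson_radical R"
      using n(2,4) jacobson_radicalD(3) by simp
    have 2: "(n \<oplus> x [^] k) \<otimes> (x \<ominus> \<one>) = x [^] Suc k \<ominus> \<one>"
    proof -
      have "(n \<oplus> x [^] k) \<otimes> (x \<ominus> \<one>) = n \<otimes> (x \<ominus> \<one>) \<oplus> x [^] k \<otimes> (x \<ominus> \<one>)"
        using n(1) c x by (simp add: l_distr)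
      also have "\<dots> = (x [^] k \<ominus> \<one>) \<oplus> (x [^] Suc k \<ominus> x [^] k)"
        using c x unfolding n(3) by (simp add: a_minus_def r_distr r_minus)
      also have "\<dots> = x [^] Suc k \<ominus> \<one>"
        using c x by (intro minus_telescope) auto
      finally show ?thesis .
    qed
    have 3: "x [^] Suc k \<ominus> \<one> \<in> jacobson_radical R"
      unfolding 2[symmetric] using n(1) c x by (intro jacobson_radicalD(6)) auto
    show ?case
      using 1 2 3 n(1) c by (intro bexI[of _ "n \<oplus> x [^] k"]) auto
  qed
  then obtain n where n: "n \<in> carrier R" "n \<ominus> [q] \<cdot> \<one> \<in> jacobson_radical R"
    "n \<otimes> (x \<ominus> \<one>) = \<zero>"
    using q by (metis a_minus_def one_closed r_neg)
  have "[q] \<cdot> \<one> \<oplus> (n \<ominus> [q] \<cdot> \<one>) = n"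
    using n(1) by (simp add: a_minus_def a_ac r_neg r_neg1 r_neg2)
  then have "n \<in> Units R"
    using unit_plus_jacobson[OF unit n(2)] by simp
  then have "x \<ominus> \<one> = \<zero>"
    using n x Units_l_cancel[of n "x \<ominus> \<one>" \<zero>] by simp
  then show ?thesis
    using x by (simp add: r_right_minus_eq)
qed

lemma add_pow_mult_jacobson:
  assumes "[(m::nat)] \<cdot> \<one> \<in> jacobson_radical R"
  shows "[(k * m::nat)] \<cdot> \<one> \<in> jacobson_radical R"
proof (induction k)
  case 0
  then show ?case
    using jacobson_radicalD(2) by simp
next
  case (Suc k)
  then show ?case
    using assms jacobson_radicalD(3) by (simp flip: add.nat_pow_mult)
qed

text \<open>A Bezout identity puts 1 into the radical. It is taken between natural numbers,
  \<open>a * p = b * q + 1\<close>, so that only natural multiples of \<open>\<one>\<close>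
  occur.\<close>

lemma coprime_in_jacobson_trivial:
  assumes "p \<noteq> 0" "coprime p q" "[(p::nat)] \<cdot> \<one> \<in> jacobson_radical R" "[(q::nat)] \<cdot> \<one> \<in> jacobson_radical R"
  shows "\<one> = \<zero>"
proof -
  obtain a b where "a * p = b * q + 1"
    using bezout_nat[OF assms(1), of q] assms(2) by (auto simp: mult.commute)
  moreover have "\<one> \<in> jacobson_radical R" if "m = n + 1" "[m] \<cdot> \<one> \<in> jacobson_radical R"
    "[n] \<cdot> \<one> \<in> jacobson_radical R" for m n :: nat
  proof -
    have "\<one> = [m] \<cdot> \<one> \<ominus> [n] \<cdot> \<one>"
      using that(1) by (simp add: a_minus_def a_ac r_neg r_neg1 r_neg2)
    then show ?thesis
      using jacobson_radicalD(4)[OF that(2,3)] by simp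
  qed
  ultimately have "\<one> \<in> jacobson_radical R"
    using add_pow_mult_jacobson[OF assms(3)] add_pow_mult_jacobson[OF assms(4)] by blast
  then show ?thesis
    using unit_in_jacobson_trivial by blast
qed

end

section \<open>The radical under surjective homomorphisms\<close>

lemma (in ring_hom_ring) hom_Units:
  assumes "u \<in> Units R"
  shows "h u \<in> Units S"
proof -
  have "h u \<otimes>\<^bsub>S\<^esub> h (inv u) = \<one>\<^bsub>S\<^esub>" "h (inv u) \<otimes>\<^bsub>S\<^esub> h u = \<one>\<^bsub>S\<^esub>"
    using assms R.Units_closed[OF assms] by (simp_all flip: hom_mult)
  then show ?thesis
    using assms by (intro S.Units_intro) auto
qed

text \<open>Surjectivity lifts the arbitrary multiplier \<open>y\<close> of the radical test to
  \<open>R\<close>, where the tested element is a unit; its image is then a unit.\<close>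

lemma (in ring_hom_ring) hom_jacobson_radical:
  assumes surj: "h ` carrier R = carrier S" and x: "x \<in> jacobson_radical R"
  shows "h x \<in> jacobson_radical S"
proof (rule S.mem_jacobson_radicalI)
  have xc: "x \<in> carrier R"
    using x R.jacobson_radicalD(1) by blast
  then show "h x \<in> carrier S"
    by simp
  fix y
  assume "y \<in> carrier S"
  then obtain z where z: "z \<in> carrier R" "y = h z"
    using surj by blast
  have "\<one> \<ominus> z \<otimes> x \<in> Units R"
    using x z R.one_minus_jacobson_Units R.jacobson_radicalD(6) by blast
  then have "h (\<one> \<ominus> z \<otimes> x) \<in> Units S"
    by (rule hom_Units)
  moreover have "h (\<one> \<ominus> z \<otimes> x) = \<one>\<^bsub>S\<^esub> \<ominus>\<^bsub>S\<^esub> y \<otimes>\<^bsub>S\<^esub> h x"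
    using xc z by (simp add: R.minus_eq S.minus_eq)
  ultimately show "\<exists>u \<in> carrier S. u \<otimes>\<^bsub>S\<^esub> (\<one>\<^bsub>S\<^esub> \<ominus>\<^bsub>S\<^esub> y \<otimes>\<^bsub>S\<^esub> h x) = \<one>\<^bsub>S\<^esub>"
    using S.Units_l_inv S.Units_inv_closed by metis
qed

lemma (in ring_hom_ring) hom_sqrt_jacobson:
  assumes surj: "h ` carrier R = carrier S" and a: "a \<in> sqrt_jacobson R"
  shows "h a \<in> sqrt_jacobson S"
  using a hom_jacobson_radical[OF surj] by (fastforce simp: sqrt_jacobson_def hom_nat_pow)

section \<open>The group ring and its augmentation\<close>

lemma (in abelian_monoid) finsum_swap:
  assumes "finite A" "finite B" "\<And>a b. a \<in> A \<Longrightarrow> b \<in> B \<Longrightarrow> f a b \<in> carrier G"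
  shows "(\<Oplus>a\<in>A. \<Oplus>b\<in>B. f a b) = (\<Oplus>b\<in>B. \<Oplus>a\<in>A. f a b)"
  using assms(1,3)
proof (induction A)
  case empty
  then show ?case
    by simp
next
  case (insert x F)
  have "(\<Oplus>a\<in>insert x F. \<Oplus>b\<in>B. f a b) = (\<Oplus>b\<in>B. f x b) \<oplus> (\<Oplus>b\<in>B. \<Oplus>a\<in>F. f a b)"
    using insert by (subst finsum_insert) (auto intro!: finsum_closed)
  also have "\<dots> = (\<Oplus>b\<in>B. f x b \<oplus> (\<Oplus>a\<in>F. f a b))"
    using insert by (subst finsum_addf) (auto intro!: finsum_closed)
  also have "\<dots> = (\<Oplus>b\<in>B. \<Oplus>a\<in>insert x F. f a b)"
    using insert by (intro finsum_cong') (auto intro!: finsum_closed a_closed simp: Pi_def)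
  finally show ?case .
qed

locale ring_and_group = R: ring R + G: group G
  for R :: "('r, 'm) ring_scheme" (structure) and G :: "('g, 'n) monoid_scheme" (structure)
begin

abbreviation "RG \<equiv> group_ring R G"

definition supp :: "('g \<Rightarrow> 'r) \<Rightarrow> 'g set"
  where "supp f = {g \<in> carrier G. f g \<noteq> \<zero>}"

text \<open>The monomial \<open>r g\<close>. The elements \<open>single \<one> g\<close> form the
  copy of \<open>G\<close> inside \<open>RG\<close>, and the elements \<open>single r \<one>\<close>
  the copy of \<open>R\<close>.\<close>

definition single :: "'r \<Rightarrow> 'g \<Rightarrow> 'g \<Rightarrow> 'r"
  where "single r g = (\<lambda>x \<in> carrier G. if x = g then r else \<zero>)"

definition aug :: "('g \<Rightarrow> 'r) \<Rightarrow> 'r"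
  where "aug f = (\<Oplus>y \<in> supp f. f y)"

lemma supp_subset: "supp f \<subseteq> carrier G"
  by (auto simp: supp_def)

lemma RG_carrierI:
  assumes "\<And>x. x \<in> carrier G \<Longrightarrow> f x \<in> carrier R" "\<And>x. x \<notin> carrier G \<Longrightarrow> f x = undefined"
    and "finite (supp f)"
  shows "f \<in> carrier RG"
  using assms by (auto simp: group_ring_def supp_def)

lemma RG_carrierD:
  assumes "f \<in> carrier RG"
  shows "x \<in> carrier G \<Longrightarrow> f x \<in> carrier R" "x \<notin> carrier G \<Longrightarrow> f x = undefined" "finite (supp f)"
  using assms by (auto simp: group_ring_def supp_def PiE_def extensional_def)

lemma RG_eqI:
  assumes "f \<in> carrier RG" "h \<in> carrier RG" "\<And>x. x \<in> carrier G \<Longrightarrow> f x = h x"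
  shows "f = h"
proof
  show "f x = h x" for x
    using assms RG_carrierD(2)[of f x] RG_carrierD(2)[of h x] by (cases "x \<in> carrier G") auto
qed

lemma RG_add: "x \<in> carrier G \<Longrightarrow> (f \<oplus>\<^bsub>RG\<^esub> h) x = f x \<oplus> h x"
  by (simp add: group_ring_def)

lemma RG_zero: "x \<in> carrier G \<Longrightarrow> \<zero>\<^bsub>RG\<^esub> x = \<zero>"
  by (simp add: group_ring_def)

lemma RG_one: "\<one>\<^bsub>RG\<^esub> = single \<one> \<one>\<^bsub>G\<^esub>"
  by (simp add: group_ring_def single_def)

lemma single_apply: "x \<in> carrier G \<Longrightarrow> single r g x = (if x = g then r else \<zero>)"
  by (simp add: single_def)

lemma supp_single: "supp (single r g) \<subseteq> {g}"
  by (auto simp: supp_def single_def)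

lemma single_closed: "r \<in> carrier R \<Longrightarrow> single r g \<in> carrier RG"
  by (rule RG_carrierI) (auto simp: single_def intro: finite_subset[OF supp_single[unfolded single_def]])

lemma RG_add_closed:
  assumes f: "f \<in> carrier RG" and h: "h \<in> carrier RG"
  shows "f \<oplus>\<^bsub>RG\<^esub> h \<in> carrier RG"
proof (rule RG_carrierI)
  have "supp (f \<oplus>\<^bsub>RG\<^esub> h) \<subseteq> supp f \<union> supp h"
    by (auto simp: supp_def RG_add)
  then show "finite (supp (f \<oplus>\<^bsub>RG\<^esub> h))"
    using RG_carrierD(3)[OF f] RG_carrierD(3)[OF h] finite_subset by blast
  show "(f \<oplus>\<^bsub>RG\<^esub> h) x \<in> carrier R" if "x \<in> carrier G" for x
    using that RG_carrierD(1)[OF f] RG_carrierD(1)[OF h] by (simp add: RG_add)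
  show "(f \<oplus>\<^bsub>RG\<^esub> h) x = undefined" if "x \<notin> carrier G" for x
    using that by (simp add: group_ring_def)
qed

lemma RG_abelian_group: "abelian_group RG"
proof (rule abelian_groupI)
  show zero: "\<zero>\<^bsub>RG\<^esub> \<in> carrier RG"
    by (auto simp: group_ring_def)
  fix f assume f: "f \<in> carrier RG"
  note fD = RG_carrierD[OF f]
  show "\<zero>\<^bsub>RG\<^esub> \<oplus>\<^bsub>RG\<^esub> f = f"
    using f zero RG_add_closed fD(1) by (intro RG_eqI) (auto simp: RG_add RG_zero)
  let ?n = "\<lambda>x \<in> carrier G. \<ominus> f x"
  have n: "?n \<in> carrier RG"
  proof (rule RG_carrierI)
    have "supp ?n \<subseteq> supp f"
      by (auto simp: supp_def)
    then show "finite (supp ?n)"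
      using fD(3) finite_subset by blast
  qed (use fD in auto)
  then show "\<exists>h \<in> carrier RG. h \<oplus>\<^bsub>RG\<^esub> f = \<zero>\<^bsub>RG\<^esub>"
    using f zero RG_add_closed fD(1)
    by (intro bexI[of _ ?n] RG_eqI) (auto simp: RG_add RG_zero R.l_neg)
  fix h assume h: "h \<in> carrier RG"
  note hD = RG_carrierD[OF h]
  show "f \<oplus>\<^bsub>RG\<^esub> h \<in> carrier RG"
    using f h by (rule RG_add_closed)
  show "f \<oplus>\<^bsub>RG\<^esub> h = h \<oplus>\<^bsub>RG\<^esub> f"
    using f h RG_add_closed fD(1) hD(1) by (intro RG_eqI) (auto simp: RG_add R.a_comm)
  fix k assume k: "k \<in> carrier RG"
  show "f \<oplus>\<^bsub>RG\<^esub> h \<oplus>\<^bsub>RG\<^esub> k = f \<oplus>\<^bsub>RG\<^esub> (h \<oplus>\<^bsub>RG\<^esub> k)"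
    using f h k RG_add_closed fD(1) hD(1) RG_carrierD(1)[OF k]
    by (intro RG_eqI) (auto simp: RG_add R.a_assoc)
qed

text \<open>Any finite set containing the support may replace it, since the added terms vanish.
  Products with different left factors can then be summed over a common index set.\<close>

lemma RG_mult_eq:
  assumes f: "f \<in> carrier RG" and h: "h \<in> carrier RG" and x: "x \<in> carrier G"
    and Y: "finite Y" "supp f \<subseteq> Y" "Y \<subseteq> carrier G"
  shows "(f \<otimes>\<^bsub>RG\<^esub> h) x = (\<Oplus>y\<in>Y. f y \<otimes> h (inv\<^bsub>G\<^esub> y \<otimes>\<^bsub>G\<^esub> x))"
proof -
  have "(f \<otimes>\<^bsub>RG\<^esub> h) x = (\<Oplus>y\<in>supp f. f y \<otimes> h (inv\<^bsub>G\<^esub> y \<otimes>\<^bsub>G\<^esub> x))"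
    using x by (simp add: group_ring_def supp_def)
  also have "\<dots> = (\<Oplus>y\<in>Y. f y \<otimes> h (inv\<^bsub>G\<^esub> y \<otimes>\<^bsub>G\<^esub> x))"
  proof (rule R.add.finprod_mono_neutral_cong_left[OF Y(1,2)])
    show "(\<lambda>y. f y \<otimes> h (inv\<^bsub>G\<^esub> y \<otimes>\<^bsub>G\<^esub> x)) \<in> Y \<rightarrow> carrier R"
      using Y(3) x RG_carrierD(1)[OF f] RG_carrierD(1)[OF h] by (auto simp: Pi_def)
    show "f y \<otimes> h (inv\<^bsub>G\<^esub> y \<otimes>\<^bsub>G\<^esub> x) = \<zero>" if "y \<in> Y - supp f" for y
      using that Y(3) x RG_carrierD(1)[OF h] by (auto simp: supp_def)
  qed simp
  finally show ?thesis .
qed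

lemma supp_mult:
  assumes f: "f \<in> carrier RG" and h: "h \<in> carrier RG"
  shows "supp (f \<otimes>\<^bsub>RG\<^esub> h) \<subseteq> (\<lambda>(y, z). y \<otimes>\<^bsub>G\<^esub> z) ` (supp f \<times> supp h)"
proof
  fix x assume x: "x \<in> supp (f \<otimes>\<^bsub>RG\<^esub> h)"
  have xG: "x \<in> carrier G"
    using x supp_subset by blast
  have "\<exists>y \<in> supp f. inv\<^bsub>G\<^esub> y \<otimes>\<^bsub>G\<^esub> x \<in> supp h"
  proof (rule ccontr)
    assume not: "\<not> ?thesis"
    have "f y \<otimes> h (inv\<^bsub>G\<^esub> y \<otimes>\<^bsub>G\<^esub> x) = \<zero>" if "y \<in> supp f" for y
      using not that xG RG_carrierD(1)[OF f] by (auto simp: supp_def)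
    then have "(\<Oplus>y\<in>supp f. f y \<otimes> h (inv\<^bsub>G\<^esub> y \<otimes>\<^bsub>G\<^esub> x)) = \<zero>"
      by (rule R.add.finprod_one_eqI)
    then show False
      using x xG RG_mult_eq[OF f h xG RG_carrierD(3)[OF f] order.refl supp_subset]
      by (simp add: supp_def)
  qed
  then obtain y where y: "y \<in> supp f" "inv\<^bsub>G\<^esub> y \<otimes>\<^bsub>G\<^esub> x \<in> supp h"
    by blast
  have "x = y \<otimes>\<^bsub>G\<^esub> (inv\<^bsub>G\<^esub> y \<otimes>\<^bsub>G\<^esub> x)"
    using y(1) supp_subset xG by (auto simp: G.inv_solve_left subset_iff G.m_assoc[symmetric])
  then show "x \<in> (\<lambda>(y, z). y \<otimes>\<^bsub>G\<^esub> z) ` (supp f \<times> supp h)"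
    using y by force
qed

lemma RG_mult_closed:
  assumes f: "f \<in> carrier RG" and h: "h \<in> carrier RG"
  shows "f \<otimes>\<^bsub>RG\<^esub> h \<in> carrier RG"
proof (rule RG_carrierI)
  show "finite (supp (f \<otimes>\<^bsub>RG\<^esub> h))"
    using RG_carrierD(3)[OF f] RG_carrierD(3)[OF h]
    by (intro finite_subset[OF supp_mult[OF f h]]) auto
  show "(f \<otimes>\<^bsub>RG\<^esub> h) x \<in> carrier R" if x: "x \<in> carrier G" for x
    unfolding RG_mult_eq[OF f h x RG_carrierD(3)[OF f] order.refl supp_subset]
    using x RG_carrierD(1)[OF f] RG_carrierD(1)[OF h] supp_subset[of f]
    by (intro R.finsum_closed) (auto simp: Pi_def subset_iff)
  show "(f \<otimes>\<^bsub>RG\<^esub> h) x = undefined" if "x \<notin> carrier G" for x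
    using that by (simp add: group_ring_def)
qed

lemma single_mult:
  assumes r: "r \<in> carrier R" and g: "g \<in> carrier G" and f: "f \<in> carrier RG" and x: "x \<in> carrier G"
  shows "(single r g \<otimes>\<^bsub>RG\<^esub> f) x = r \<otimes> f (inv\<^bsub>G\<^esub> g \<otimes>\<^bsub>G\<^esub> x)"
proof -
  have "(single r g \<otimes>\<^bsub>RG\<^esub> f) x = (\<Oplus>y\<in>{g}. single r g y \<otimes> f (inv\<^bsub>G\<^esub> y \<otimes>\<^bsub>G\<^esub> x))"
    using r f x g supp_single by (intro RG_mult_eq single_closed) auto
  then show ?thesis
    using r g x RG_carrierD(1)[OF f] by (simp add: single_def)
qed

lemma mult_single:
  assumes r: "r \<in> carrier R" and g: "g \<in> carrier G" and f: "f \<in> carrier RG" and x: "x \<in> carrier G"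
  shows "(f \<otimes>\<^bsub>RG\<^esub> single r g) x = f (x \<otimes>\<^bsub>G\<^esub> inv\<^bsub>G\<^esub> g) \<otimes> r"
proof -
  let ?z = "x \<otimes>\<^bsub>G\<^esub> inv\<^bsub>G\<^esub> g"
  let ?Y = "insert ?z (supp f)"
  have Y: "finite ?Y" "supp f \<subseteq> ?Y" "?Y \<subseteq> carrier G"
    using RG_carrierD(3)[OF f] supp_subset x g by auto
  have "(f \<otimes>\<^bsub>RG\<^esub> single r g) x = (\<Oplus>y\<in>?Y. f y \<otimes> single r g (inv\<^bsub>G\<^esub> y \<otimes>\<^bsub>G\<^esub> x))"
    using RG_mult_eq[OF f single_closed[OF r] x Y] .
  also have "\<dots> = (\<Oplus>y\<in>?Y. if ?z = y then f y \<otimes> r else \<zero>)"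
  proof (rule R.finsum_cong')
    fix y assume y: "y \<in> ?Y"
    then have yG: "y \<in> carrier G"
      using Y(3) by blast
    have "inv\<^bsub>G\<^esub> y \<otimes>\<^bsub>G\<^esub> x = g \<longleftrightarrow> ?z = y"
      using yG x g by (metis G.inv_closed G.inv_solve_left' G.inv_solve_right')
    then show "f y \<otimes> single r g (inv\<^bsub>G\<^esub> y \<otimes>\<^bsub>G\<^esub> x) = (if ?z = y then f y \<otimes> r else \<zero>)"
      using yG x RG_carrierD(1)[OF f] by (simp add: single_apply)
  qed (use Y(3) RG_carrierD(1)[OF f] r in \<open>auto simp: Pi_def\<close>)
  also have "\<dots> = f ?z \<otimes> r"
    using Y RG_carrierD(1)[OF f] r
    by (intro R.add.finprod_singleton) (auto simp: Pi_def)
  finally show ?thesis .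
qed

lemma RG_mult_assoc:
  assumes f: "f \<in> carrier RG" and h: "h \<in> carrier RG" and k: "k \<in> carrier RG"
  shows "f \<otimes>\<^bsub>RG\<^esub> h \<otimes>\<^bsub>RG\<^esub> k = f \<otimes>\<^bsub>RG\<^esub> (h \<otimes>\<^bsub>RG\<^esub> k)"
proof (rule RG_eqI)
  show "f \<otimes>\<^bsub>RG\<^esub> h \<otimes>\<^bsub>RG\<^esub> k \<in> carrier RG" "f \<otimes>\<^bsub>RG\<^esub> (h \<otimes>\<^bsub>RG\<^esub> k) \<in> carrier RG"
    using f h k by (auto intro: RG_mult_closed)
  fix x assume x: "x \<in> carrier G"
  note fc = RG_carrierD(1)[OF f] and hc = RG_carrierD(1)[OF h] and kc = RG_carrierD(1)[OF k]
  \<comment> \<open>All products of support elements are included so that, for each \<open>z\<close>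
    in the support of \<open>f\<close>, the translate of \<open>Y\<close> by the inverse of
    \<open>z\<close> covers the support of \<open>h\<close>. The substitution in the inner sum then
    loses no term.\<close>
  define Y where "Y = (\<lambda>(y, z). y \<otimes>\<^bsub>G\<^esub> z) ` (supp f \<times> supp h)"
  have Y: "finite Y" "supp (f \<otimes>\<^bsub>RG\<^esub> h) \<subseteq> Y" "Y \<subseteq> carrier G"
    using supp_mult[OF f h] RG_carrierD(3)[OF f] RG_carrierD(3)[OF h] supp_subset
    by (auto simp: Y_def subset_iff)
  have F: "finite (supp f)" "supp f \<subseteq> carrier G" "\<And>y. y \<in> supp f \<Longrightarrow> y \<in> carrier G"
    using RG_carrierD(3)[OF f] supp_subset by auto
  have YG: "\<And>y. y \<in> Y \<Longrightarrow> y \<in> carrier G"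
    using Y by blast
  have inner: "(\<Oplus>y\<in>Y. h (inv\<^bsub>G\<^esub> z \<otimes>\<^bsub>G\<^esub> y) \<otimes> k (inv\<^bsub>G\<^esub> y \<otimes>\<^bsub>G\<^esub> x)) =
      (h \<otimes>\<^bsub>RG\<^esub> k) (inv\<^bsub>G\<^esub> z \<otimes>\<^bsub>G\<^esub> x)" if z: "z \<in> supp f" for z
  proof -
    have zG: "z \<in> carrier G"
      using z F by blast
    let ?t = "\<lambda>y. inv\<^bsub>G\<^esub> z \<otimes>\<^bsub>G\<^esub> y"
    have inj: "inj_on ?t Y"
      using zG YG by (auto simp: inj_on_def)
    have tY: "finite (?t ` Y)" "supp h \<subseteq> ?t ` Y" "?t ` Y \<subseteq> carrier G"
    proof -
      show "supp h \<subseteq> ?t ` Y"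
      proof
        fix w assume w: "w \<in> supp h"
        then have "w \<in> carrier G"
          using supp_subset by blast
        then have "w = ?t (z \<otimes>\<^bsub>G\<^esub> w)"
          using zG by (simp flip: G.m_assoc)
        moreover have "z \<otimes>\<^bsub>G\<^esub> w \<in> Y"
          using w z by (auto simp: Y_def)
        ultimately show "w \<in> ?t ` Y"
          by blast
      qed
    qed (use Y YG zG in auto)
    have "(h \<otimes>\<^bsub>RG\<^esub> k) (inv\<^bsub>G\<^esub> z \<otimes>\<^bsub>G\<^esub> x) =
        (\<Oplus>w\<in>?t ` Y. h w \<otimes> k (inv\<^bsub>G\<^esub> w \<otimes>\<^bsub>G\<^esub> (inv\<^bsub>G\<^esub> z \<otimes>\<^bsub>G\<^esub> x)))"
      using zG x by (intro RG_mult_eq[OF h k _ tY]) auto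
    also have "\<dots> = (\<Oplus>y\<in>Y. h (?t y) \<otimes> k (inv\<^bsub>G\<^esub> (?t y) \<otimes>\<^bsub>G\<^esub> (inv\<^bsub>G\<^esub> z \<otimes>\<^bsub>G\<^esub> x)))"
      using inj YG zG x hc kc by (intro R.finsum_reindex) auto
    also have "\<dots> = (\<Oplus>y\<in>Y. h (?t y) \<otimes> k (inv\<^bsub>G\<^esub> y \<otimes>\<^bsub>G\<^esub> x))"
    proof (rule R.finsum_cong')
      fix y assume "y \<in> Y"
      then have "inv\<^bsub>G\<^esub> (?t y) \<otimes>\<^bsub>G\<^esub> (inv\<^bsub>G\<^esub> z \<otimes>\<^bsub>G\<^esub> x) = inv\<^bsub>G\<^esub> y \<otimes>\<^bsub>G\<^esub> x"
        using zG x YG by (simp add: G.inv_mult_group G.m_assoc flip: G.m_assoc[of z])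
      then show "h (?t y) \<otimes> k (inv\<^bsub>G\<^esub> (?t y) \<otimes>\<^bsub>G\<^esub> (inv\<^bsub>G\<^esub> z \<otimes>\<^bsub>G\<^esub> x)) =
          h (?t y) \<otimes> k (inv\<^bsub>G\<^esub> y \<otimes>\<^bsub>G\<^esub> x)"
        by simp
    qed (use YG zG x hc kc in auto)
    finally show ?thesis
      by simp
  qed
  have "(f \<otimes>\<^bsub>RG\<^esub> h \<otimes>\<^bsub>RG\<^esub> k) x = (\<Oplus>y\<in>Y. (f \<otimes>\<^bsub>RG\<^esub> h) y \<otimes> k (inv\<^bsub>G\<^esub> y \<otimes>\<^bsub>G\<^esub> x))"
    using RG_mult_eq[OF RG_mult_closed[OF f h] k x Y] .
  also have "\<dots> = (\<Oplus>y\<in>Y. \<Oplus>z\<in>supp f. f z \<otimes> (h (inv\<^bsub>G\<^esub> z \<otimes>\<^bsub>G\<^esub> y) \<otimes> k (inv\<^bsub>G\<^esub> y \<otimes>\<^bsub>G\<^esub> x)))"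
  proof (rule R.finsum_cong')
    fix y assume "y \<in> Y"
    then have yG: "y \<in> carrier G"
      using YG by blast
    have "(f \<otimes>\<^bsub>RG\<^esub> h) y \<otimes> k (inv\<^bsub>G\<^esub> y \<otimes>\<^bsub>G\<^esub> x) =
        (\<Oplus>z\<in>supp f. f z \<otimes> h (inv\<^bsub>G\<^esub> z \<otimes>\<^bsub>G\<^esub> y)) \<otimes> k (inv\<^bsub>G\<^esub> y \<otimes>\<^bsub>G\<^esub> x)"
      using RG_mult_eq[OF f h yG F(1) order.refl F(2)] by simp
    also have "\<dots> = (\<Oplus>z\<in>supp f. f z \<otimes> h (inv\<^bsub>G\<^esub> z \<otimes>\<^bsub>G\<^esub> y) \<otimes> k (inv\<^bsub>G\<^esub> y \<otimes>\<^bsub>G\<^esub> x))"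
      using F yG x fc hc kc by (intro R.finsum_ldistr) auto
    also have "\<dots> = (\<Oplus>z\<in>supp f. f z \<otimes> (h (inv\<^bsub>G\<^esub> z \<otimes>\<^bsub>G\<^esub> y) \<otimes> k (inv\<^bsub>G\<^esub> y \<otimes>\<^bsub>G\<^esub> x)))"
      using F yG x fc hc kc by (intro R.finsum_cong') (auto simp: R.m_assoc)
    finally show "(f \<otimes>\<^bsub>RG\<^esub> h) y \<otimes> k (inv\<^bsub>G\<^esub> y \<otimes>\<^bsub>G\<^esub> x) =
      (\<Oplus>z\<in>supp f. f z \<otimes> (h (inv\<^bsub>G\<^esub> z \<otimes>\<^bsub>G\<^esub> y) \<otimes> k (inv\<^bsub>G\<^esub> y \<otimes>\<^bsub>G\<^esub> x)))" .
  qed (use F YG x fc hc kc in \<open>auto intro!: R.finsum_closed\<close>)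
  also have "\<dots> = (\<Oplus>z\<in>supp f. \<Oplus>y\<in>Y. f z \<otimes> (h (inv\<^bsub>G\<^esub> z \<otimes>\<^bsub>G\<^esub> y) \<otimes> k (inv\<^bsub>G\<^esub> y \<otimes>\<^bsub>G\<^esub> x)))"
    using F YG x fc hc kc Y(1) by (intro R.finsum_swap) auto
  also have "\<dots> = (\<Oplus>z\<in>supp f. f z \<otimes> (h \<otimes>\<^bsub>RG\<^esub> k) (inv\<^bsub>G\<^esub> z \<otimes>\<^bsub>G\<^esub> x))"
  proof (rule R.finsum_cong')
    fix z assume z: "z \<in> supp f"
    have "(\<Oplus>y\<in>Y. f z \<otimes> (h (inv\<^bsub>G\<^esub> z \<otimes>\<^bsub>G\<^esub> y) \<otimes> k (inv\<^bsub>G\<^esub> y \<otimes>\<^bsub>G\<^esub> x))) =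
        f z \<otimes> (\<Oplus>y\<in>Y. h (inv\<^bsub>G\<^esub> z \<otimes>\<^bsub>G\<^esub> y) \<otimes> k (inv\<^bsub>G\<^esub> y \<otimes>\<^bsub>G\<^esub> x))"
      using F(3)[OF z] Y(1) YG x fc hc kc by (intro R.finsum_rdistr[symmetric]) auto
    then show "(\<Oplus>y\<in>Y. f z \<otimes> (h (inv\<^bsub>G\<^esub> z \<otimes>\<^bsub>G\<^esub> y) \<otimes> k (inv\<^bsub>G\<^esub> y \<otimes>\<^bsub>G\<^esub> x))) =
        f z \<otimes> (h \<otimes>\<^bsub>RG\<^esub> k) (inv\<^bsub>G\<^esub> z \<otimes>\<^bsub>G\<^esub> x)"
      unfolding inner[OF z] .
  qed (use F x fc RG_carrierD(1)[OF RG_mult_closed[OF h k]] in auto)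
  also have "\<dots> = (f \<otimes>\<^bsub>RG\<^esub> (h \<otimes>\<^bsub>RG\<^esub> k)) x"
    using RG_mult_eq[OF f RG_mult_closed[OF h k] x F(1) order.refl F(2)] by simp
  finally show "(f \<otimes>\<^bsub>RG\<^esub> h \<otimes>\<^bsub>RG\<^esub> k) x = (f \<otimes>\<^bsub>RG\<^esub> (h \<otimes>\<^bsub>RG\<^esub> k)) x" .
qed

lemma ring_RG: "ring RG"
proof (rule ringI)
  show "abelian_group RG"
    by (rule RG_abelian_group)
  have one: "\<one>\<^bsub>RG\<^esub> \<in> carrier RG"
    by (simp add: RG_one single_closed)
  show "Group.monoid RG"
  proof (rule monoidI)
    fix f assume f: "f \<in> carrier RG"
    show "\<one>\<^bsub>RG\<^esub> \<otimes>\<^bsub>RG\<^esub> f = f"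
      using f one RG_carrierD(1)[OF f] unfolding RG_one
      by (intro RG_eqI RG_mult_closed) (auto simp: single_mult)
    show "f \<otimes>\<^bsub>RG\<^esub> \<one>\<^bsub>RG\<^esub> = f"
      using f one RG_carrierD(1)[OF f] unfolding RG_one
      by (intro RG_eqI RG_mult_closed) (auto simp: mult_single)
  qed (auto simp: one RG_mult_closed RG_mult_assoc)
  fix f h k assume f: "f \<in> carrier RG" and h: "h \<in> carrier RG" and k: "k \<in> carrier RG"
  note fc = RG_carrierD(1)[OF f] and hc = RG_carrierD(1)[OF h] and kc = RG_carrierD(1)[OF k]
  note fh = RG_add_closed[OF f h]
  show "(f \<oplus>\<^bsub>RG\<^esub> h) \<otimes>\<^bsub>RG\<^esub> k = f \<otimes>\<^bsub>RG\<^esub> k \<oplus>\<^bsub>RG\<^esub> h \<otimes>\<^bsub>RG\<^esub> k"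
  proof (rule RG_eqI)
    fix x assume x: "x \<in> carrier G"
    let ?Y = "supp f \<union> supp h"
    have Y: "finite ?Y" "?Y \<subseteq> carrier G" "\<And>y. y \<in> ?Y \<Longrightarrow> y \<in> carrier G"
      using RG_carrierD(3)[OF f] RG_carrierD(3)[OF h] supp_subset by auto
    have "supp (f \<oplus>\<^bsub>RG\<^esub> h) \<subseteq> ?Y"
      by (auto simp: supp_def RG_add)
    then have "((f \<oplus>\<^bsub>RG\<^esub> h) \<otimes>\<^bsub>RG\<^esub> k) x = (\<Oplus>y\<in>?Y. (f \<oplus>\<^bsub>RG\<^esub> h) y \<otimes> k (inv\<^bsub>G\<^esub> y \<otimes>\<^bsub>G\<^esub> x))"
      by (intro RG_mult_eq[OF fh k x Y(1) _ Y(2)])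
    also have "\<dots> = (\<Oplus>y\<in>?Y. f y \<otimes> k (inv\<^bsub>G\<^esub> y \<otimes>\<^bsub>G\<^esub> x) \<oplus> h y \<otimes> k (inv\<^bsub>G\<^esub> y \<otimes>\<^bsub>G\<^esub> x))"
      using Y(3) x fc hc kc by (intro R.finsum_cong') (auto simp: RG_add R.l_distr)
    also have "\<dots> = (\<Oplus>y\<in>?Y. f y \<otimes> k (inv\<^bsub>G\<^esub> y \<otimes>\<^bsub>G\<^esub> x)) \<oplus> (\<Oplus>y\<in>?Y. h y \<otimes> k (inv\<^bsub>G\<^esub> y \<otimes>\<^bsub>G\<^esub> x))"
      using Y(3) x fc hc kc by (intro R.finsum_addf) auto
    also have "\<dots> = (f \<otimes>\<^bsub>RG\<^esub> k \<oplus>\<^bsub>RG\<^esub> h \<otimes>\<^bsub>RG\<^esub> k) x"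
      using RG_mult_eq[OF f k x Y(1) _ Y(2)] RG_mult_eq[OF h k x Y(1) _ Y(2)] x
      by (simp add: RG_add)
    finally show "((f \<oplus>\<^bsub>RG\<^esub> h) \<otimes>\<^bsub>RG\<^esub> k) x = (f \<otimes>\<^bsub>RG\<^esub> k \<oplus>\<^bsub>RG\<^esub> h \<otimes>\<^bsub>RG\<^esub> k) x" .
  qed (use f h k in \<open>auto intro: RG_add_closed RG_mult_closed\<close>)
  show "k \<otimes>\<^bsub>RG\<^esub> (f \<oplus>\<^bsub>RG\<^esub> h) = k \<otimes>\<^bsub>RG\<^esub> f \<oplus>\<^bsub>RG\<^esub> k \<otimes>\<^bsub>RG\<^esub> h"
  proof (rule RG_eqI)
    fix x assume x: "x \<in> carrier G"
    have Y: "finite (supp k)" "supp k \<subseteq> carrier G" "\<And>y. y \<in> supp k \<Longrightarrow> y \<in> carrier G"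
      using RG_carrierD(3)[OF k] supp_subset by auto
    have "(k \<otimes>\<^bsub>RG\<^esub> (f \<oplus>\<^bsub>RG\<^esub> h)) x = (\<Oplus>y\<in>supp k. k y \<otimes> (f \<oplus>\<^bsub>RG\<^esub> h) (inv\<^bsub>G\<^esub> y \<otimes>\<^bsub>G\<^esub> x))"
      by (intro RG_mult_eq[OF k fh x Y(1) _ Y(2)]) simp
    also have "\<dots> = (\<Oplus>y\<in>supp k. k y \<otimes> f (inv\<^bsub>G\<^esub> y \<otimes>\<^bsub>G\<^esub> x) \<oplus> k y \<otimes> h (inv\<^bsub>G\<^esub> y \<otimes>\<^bsub>G\<^esub> x))"
      using Y(3) x fc hc kc by (intro R.finsum_cong') (auto simp: RG_add R.r_distr)
    also have "\<dots> = (\<Oplus>y\<in>supp k. k y \<otimes> f (inv\<^bsub>G\<^esub> y \<otimes>\<^bsub>G\<^esub> x)) \<oplus> (\<Oplus>y\<in>supp k. k y \<otimes> h (inv\<^bsub>G\<^esub> y \<otimes>\<^bsub>G\<^esub> x))"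
      using Y(3) x fc hc kc by (intro R.finsum_addf) auto
    also have "\<dots> = (k \<otimes>\<^bsub>RG\<^esub> f \<oplus>\<^bsub>RG\<^esub> k \<otimes>\<^bsub>RG\<^esub> h) x"
      using RG_mult_eq[OF k f x Y(1) _ Y(2)] RG_mult_eq[OF k h x Y(1) _ Y(2)] x
      by (simp add: RG_add)
    finally show "(k \<otimes>\<^bsub>RG\<^esub> (f \<oplus>\<^bsub>RG\<^esub> h)) x = (k \<otimes>\<^bsub>RG\<^esub> f \<oplus>\<^bsub>RG\<^esub> k \<otimes>\<^bsub>RG\<^esub> h) x" .
  qed (use f h k in \<open>auto intro: RG_add_closed RG_mult_closed\<close>)
qed

sublocale RG: ring RG
  by (rule ring_RG)

text \<open>Subtraction goes through the abstract additive inverse of the ring, so the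
  coefficientwise formula is recovered by solving \<open>f = (f - h) + h\<close>.\<close>

lemma RG_minus:
  assumes f: "f \<in> carrier RG" and h: "h \<in> carrier RG" and x: "x \<in> carrier G"
  shows "(f \<ominus>\<^bsub>RG\<^esub> h) x = f x \<ominus> h x"
proof -
  note fc = RG_carrierD(1)[OF f x] and hc = RG_carrierD(1)[OF h x]
  have mc: "(f \<ominus>\<^bsub>RG\<^esub> h) x \<in> carrier R"
    using RG_carrierD(1)[of "f \<ominus>\<^bsub>RG\<^esub> h"] f h x by simp
  have "f = (f \<ominus>\<^bsub>RG\<^esub> h) \<oplus>\<^bsub>RG\<^esub> h"
    using f h by (simp add: RG.minus_eq RG.a_assoc RG.l_neg)
  then have "f x = (f \<ominus>\<^bsub>RG\<^esub> h) x \<oplus> h x"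
    using x RG_add by metis
  then show ?thesis
    using mc hc by (simp add: R.minus_eq R.a_assoc R.r_neg)
qed

section \<open>The augmentation homomorphism\<close>

lemma aug_eq:
  assumes f: "f \<in> carrier RG" and Y: "finite Y" "supp f \<subseteq> Y" "Y \<subseteq> carrier G"
  shows "aug f = (\<Oplus>y\<in>Y. f y)"
  unfolding aug_def
proof (rule R.add.finprod_mono_neutral_cong_left[OF Y(1,2)])
  show "f \<in> Y \<rightarrow> carrier R"
    using Y(3) RG_carrierD(1)[OF f] by auto
  show "f y = \<zero>" if "y \<in> Y - supp f" for y
    using that Y(3) by (auto simp: supp_def)
qed simp

lemma aug_single: "r \<in> carrier R \<Longrightarrow> g \<in> carrier G \<Longrightarrow> aug (single r g) = r"
  using aug_eq[OF single_closed _ supp_single, of r g] by (simp add: single_apply)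

lemma ring_hom_aug: "ring_hom_ring RG R aug"
proof (rule ring_hom_ringI)
  show "ring RG" "ring R"
    by (rule ring_RG, rule R.ring_axioms)
  show "aug \<one>\<^bsub>RG\<^esub> = \<one>"
    by (simp add: RG_one aug_single)
  fix f assume f: "f \<in> carrier RG"
  note fc = RG_carrierD(1)[OF f]
  have F: "finite (supp f)" "supp f \<subseteq> carrier G" "\<And>y. y \<in> supp f \<Longrightarrow> y \<in> carrier G"
    using RG_carrierD(3)[OF f] supp_subset by auto
  have augc: "aug f \<in> carrier R" if "f \<in> carrier RG" for f
    unfolding aug_def using RG_carrierD(1)[OF that] supp_subset by (intro R.finsum_closed) blast
  show "aug f \<in> carrier R"
    by (rule augc[OF f])
  fix h assume h: "h \<in> carrier RG"
  note hc = RG_carrierD(1)[OF h] and augh = augc[OF h]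
  have H: "finite (supp h)" "supp h \<subseteq> carrier G"
    using RG_carrierD(3)[OF h] supp_subset by auto
  show "aug (f \<oplus>\<^bsub>RG\<^esub> h) = aug f \<oplus> aug h"
  proof -
    let ?Y = "supp f \<union> supp h"
    have Y: "finite ?Y" "?Y \<subseteq> carrier G" "\<And>y. y \<in> ?Y \<Longrightarrow> y \<in> carrier G"
      using F H by auto
    have "supp (f \<oplus>\<^bsub>RG\<^esub> h) \<subseteq> ?Y"
      by (auto simp: supp_def RG_add)
    then have "aug (f \<oplus>\<^bsub>RG\<^esub> h) = (\<Oplus>y\<in>?Y. (f \<oplus>\<^bsub>RG\<^esub> h) y)"
      using aug_eq[OF RG_add_closed[OF f h] Y(1) _ Y(2)] by simp
    also have "\<dots> = (\<Oplus>y\<in>?Y. f y \<oplus> h y)"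
      using Y(3) fc hc by (intro R.finsum_cong') (auto simp: RG_add)
    also have "\<dots> = (\<Oplus>y\<in>?Y. f y) \<oplus> (\<Oplus>y\<in>?Y. h y)"
      using Y(3) fc hc by (intro R.finsum_addf) auto
    finally show ?thesis
      using aug_eq[OF f Y(1) _ Y(2)] aug_eq[OF h Y(1) _ Y(2)] by simp
  qed
  show "aug (f \<otimes>\<^bsub>RG\<^esub> h) = aug f \<otimes> aug h"
  proof -
    define Y where "Y = (\<lambda>(y, z). y \<otimes>\<^bsub>G\<^esub> z) ` (supp f \<times> supp h)"
    have Y: "finite Y" "supp (f \<otimes>\<^bsub>RG\<^esub> h) \<subseteq> Y" "Y \<subseteq> carrier G"
      using supp_mult[OF f h] F H by (auto simp: Y_def subset_iff)
    have YG: "\<And>y. y \<in> Y \<Longrightarrow> y \<in> carrier G"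
      using Y by blast
    \<comment> \<open>Translating \<open>Y\<close> by the inverse of \<open>y\<close> covers the
      support of \<open>h\<close>, so every inner sum is the full augmentation of \<open>h\<close>,
      independently of \<open>y\<close>.\<close>
    have inner: "(\<Oplus>x\<in>Y. h (inv\<^bsub>G\<^esub> y \<otimes>\<^bsub>G\<^esub> x)) = aug h" if y: "y \<in> supp f" for y
    proof -
      have yG: "y \<in> carrier G"
        using y F by blast
      let ?t = "\<lambda>x. inv\<^bsub>G\<^esub> y \<otimes>\<^bsub>G\<^esub> x"
      have "supp h \<subseteq> ?t ` Y"
      proof
        fix w assume w: "w \<in> supp h"
        then have "w = ?t (y \<otimes>\<^bsub>G\<^esub> w)"
          using yG H by (simp add: subset_iff flip: G.m_assoc)
        moreover have "y \<otimes>\<^bsub>G\<^esub> w \<in> Y"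
          using w y by (auto simp: Y_def)
        ultimately show "w \<in> ?t ` Y"
          by blast
      qed
      then have "aug h = (\<Oplus>w\<in>?t ` Y. h w)"
        using Y YG yG by (intro aug_eq[OF h]) auto
      also have "\<dots> = (\<Oplus>x\<in>Y. h (?t x))"
        using YG yG hc by (intro R.finsum_reindex) (auto simp: inj_on_def)
      finally show ?thesis
        by simp
    qed
    have "aug (f \<otimes>\<^bsub>RG\<^esub> h) = (\<Oplus>x\<in>Y. (f \<otimes>\<^bsub>RG\<^esub> h) x)"
      by (rule aug_eq[OF RG_mult_closed[OF f h] Y])
    also have "\<dots> = (\<Oplus>x\<in>Y. \<Oplus>y\<in>supp f. f y \<otimes> h (inv\<^bsub>G\<^esub> y \<otimes>\<^bsub>G\<^esub> x))"
      using RG_mult_eq[OF f h _ F(1) order.refl F(2)] YG F(3) fc hc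
      by (intro R.finsum_cong') (auto intro!: R.finsum_closed)
    also have "\<dots> = (\<Oplus>y\<in>supp f. \<Oplus>x\<in>Y. f y \<otimes> h (inv\<^bsub>G\<^esub> y \<otimes>\<^bsub>G\<^esub> x))"
      using F YG Y(1) fc hc by (intro R.finsum_swap) auto
    also have "\<dots> = (\<Oplus>y\<in>supp f. f y \<otimes> aug h)"
    proof (rule R.finsum_cong')
      fix y assume y: "y \<in> supp f"
      have "(\<Oplus>x\<in>Y. f y \<otimes> h (inv\<^bsub>G\<^esub> y \<otimes>\<^bsub>G\<^esub> x)) = f y \<otimes> (\<Oplus>x\<in>Y. h (inv\<^bsub>G\<^esub> y \<otimes>\<^bsub>G\<^esub> x))"
        using F(3)[OF y] Y(1) YG fc hc by (intro R.finsum_rdistr[symmetric]) auto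
      then show "(\<Oplus>x\<in>Y. f y \<otimes> h (inv\<^bsub>G\<^esub> y \<otimes>\<^bsub>G\<^esub> x)) = f y \<otimes> aug h"
        unfolding inner[OF y] .
    qed (use F(3) fc augh in auto)
    also have "\<dots> = aug f \<otimes> aug h"
      using R.finsum_ldistr[OF F(1) augh, of f] F(3) fc by (simp add: aug_def Pi_def)
    finally show ?thesis .
  qed
qed

sublocale aug: ring_hom_ring RG R aug
  by (rule ring_hom_aug)

lemma aug_surj: "aug ` carrier RG = carrier R"
proof
  show "aug ` carrier RG \<subseteq> carrier R"
    by auto
  show "carrier R \<subseteq> aug ` carrier RG"
  proof
    fix r assume "r \<in> carrier R"
    then show "r \<in> aug ` carrier RG"
      using aug_single[of r "\<one>\<^bsub>G\<^esub>"] single_closed by (intro image_eqI[of _ _ "single r \<one>\<^bsub>G\<^esub>"]) auto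
  qed
qed

end

section \<open>Necessity\<close>

text \<open>A preimage of a nonradical element is nonradical, because radical elements map to
  radical ones; the two summands of its decomposition map to summands of the same kind.\<close>

lemma (in ring_hom_ring) generalized_sqrtJ_fine_image:
  assumes surj: "h ` carrier R = carrier S" and fine: "generalized_sqrtJ_fine R"
  shows "generalized_sqrtJ_fine S"
  unfolding generalized_sqrtJ_fine_def
proof
  fix s assume s: "s \<in> carrier S - jacobson_radical S"
  then obtain r where r: "r \<in> carrier R" "s = h r"
    using surj by blast
  then have "r \<notin> jacobson_radical R"
    using s hom_jacobson_radical[OF surj] by blast
  then obtain u a where u: "u \<in> Units R" and a: "a \<in> sqrt_jacobson R" and eq: "r = u \<oplus> a"
    using fine r unfolding generalized_sqrtJ_fine_def by blast
  have "a \<in> carrier R"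
    using a by (simp add: sqrt_jacobson_def)
  then have "s = h u \<oplus>\<^bsub>S\<^esub> h a"
    using R.Units_closed[OF u] r eq by simp
  then show "\<exists>u \<in> Units S. \<exists>a \<in> sqrt_jacobson S. s = u \<oplus>\<^bsub>S\<^esub> a"
    using hom_Units[OF u] hom_sqrt_jacobson[OF surj a] by blast
qed

lemma (in ring_hom_ring) kernel_in_jacobson_radical:
  assumes surj: "h ` carrier R = carrier S" and fine: "generalized_sqrtJ_fine R"
    and nontriv: "\<one>\<^bsub>S\<^esub> \<noteq> \<zero>\<^bsub>S\<^esub>" and x: "x \<in> carrier R" "h x = \<zero>\<^bsub>S\<^esub>"
  shows "x \<in> jacobson_radical R"
proof (rule ccontr)
  assume "x \<notin> jacobson_radical R"
  then obtain u a where u: "u \<in> Units R" and a: "a \<in> sqrt_jacobson R" and eq: "x = u \<oplus> a"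
    using fine x unfolding generalized_sqrtJ_fine_def by blast
  have ac: "a \<in> carrier R"
    using a by (simp add: sqrt_jacobson_def)
  have uc: "u \<in> carrier R"
    using u by (rule R.Units_closed)
  have "h u \<oplus>\<^bsub>S\<^esub> h a = \<zero>\<^bsub>S\<^esub>"
    using x(2) eq uc ac by simp
  then have "h a = \<ominus>\<^bsub>S\<^esub> (h u)"
    using uc ac by (metis S.a_comm S.minus_equality hom_closed)
  then have "h a \<in> Units S"
    using S.Units_a_inv[OF hom_Units[OF u]] by simp
  then show False
    using S.unit_in_sqrt_jacobson_trivial hom_sqrt_jacobson[OF surj a] nontriv by blast
qed

context ring_and_group
begin

lemma single_mult_single:
  assumes "r \<in> carrier R" "s \<in> carrier R" "g \<in> carrier G" "h \<in> carrier G"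
  shows "single r g \<otimes>\<^bsub>RG\<^esub> single s h = single (r \<otimes> s) (g \<otimes>\<^bsub>G\<^esub> h)"
proof (rule RG_eqI)
  fix x assume x: "x \<in> carrier G"
  have "inv\<^bsub>G\<^esub> g \<otimes>\<^bsub>G\<^esub> x = h \<longleftrightarrow> x = g \<otimes>\<^bsub>G\<^esub> h"
    using assms x by (metis G.inv_solve_left)
  then show "(single r g \<otimes>\<^bsub>RG\<^esub> single s h) x = single (r \<otimes> s) (g \<otimes>\<^bsub>G\<^esub> h) x"
    using assms x by (simp add: single_mult single_closed single_apply)
qed (use assms in \<open>auto intro: single_closed RG_mult_closed\<close>)

lemma single_pow:
  assumes "g \<in> carrier G"
  shows "single \<one> g [^]\<^bsub>RG\<^esub> (n::nat) = single \<one> (g [^]\<^bsub>G\<^esub> n)"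
  using assms by (induction n) (auto simp: single_mult_single RG_one)

lemma single_minus_one_augmentation:
  assumes "g \<in> carrier G"
  shows "aug (single \<one> g \<ominus>\<^bsub>RG\<^esub> \<one>\<^bsub>RG\<^esub>) = \<zero>"
proof -
  have "aug (single \<one> g \<ominus>\<^bsub>RG\<^esub> \<one>\<^bsub>RG\<^esub>) = aug (single \<one> g) \<ominus> \<one>"
    using single_closed by (simp add: RG.minus_eq R.minus_eq)
  then show ?thesis
    using assms by (simp add: aug_single R.minus_eq R.r_neg)
qed

text \<open>If \<open>g\<close> had infinite order, then \<open>1 - g + g\<^sup>2\<close> would be a unit; but multiplication by it
  increases the width of the support along the powers of \<open>g\<close>.\<close>

lemma finite_order_of_jacobson:
  assumes nontriv: "\<one> \<noteq> \<zero>" and g: "g \<in> carrier G"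
    and j: "single \<one> g \<ominus>\<^bsub>RG\<^esub> \<one>\<^bsub>RG\<^esub> \<in> jacobson_radical RG"
  shows "G.ord g \<noteq> 0"
proof
  assume ord: "G.ord g = 0"
  define e where "e = single \<one> g"
  have e: "e \<in> carrier RG" "e \<otimes>\<^bsub>RG\<^esub> e = single \<one> (g \<otimes>\<^bsub>G\<^esub> g)"
    using g by (auto simp: e_def single_closed single_mult_single)
  \<comment> \<open>Subtracting this radical element from 1 gives \<open>1 - e + e^2\<close>, whose
    lowest and highest coefficients are both 1, so over any \<open>R\<close> nothing cancels at the
    ends. The simpler \<open>1 - (e - 1) = 2 - e\<close> would not do: it is the unit
    \<open>-e\<close> when 2 is zero in \<open>R\<close>.\<close>
  have "\<ominus>\<^bsub>RG\<^esub> e \<otimes>\<^bsub>RG\<^esub> (e \<ominus>\<^bsub>RG\<^esub> \<one>\<^bsub>RG\<^esub>) \<in> jacobson_radical RG"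
    using j e by (intro RG.jacobson_radicalD(6)) (auto simp: e_def)
  then obtain u where u: "u \<in> carrier RG"
    "u \<otimes>\<^bsub>RG\<^esub> (\<one>\<^bsub>RG\<^esub> \<ominus>\<^bsub>RG\<^esub> (\<ominus>\<^bsub>RG\<^esub> e \<otimes>\<^bsub>RG\<^esub> (e \<ominus>\<^bsub>RG\<^esub> \<one>\<^bsub>RG\<^esub>))) = \<one>\<^bsub>RG\<^esub>"
    using RG.one_minus_jacobson_left_inverse by blast
  note uc = RG_carrierD(1)[OF u(1)]
  have one: "\<one>\<^bsub>RG\<^esub> = (u \<ominus>\<^bsub>RG\<^esub> u \<otimes>\<^bsub>RG\<^esub> e) \<oplus>\<^bsub>RG\<^esub> u \<otimes>\<^bsub>RG\<^esub> (e \<otimes>\<^bsub>RG\<^esub> e)"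
    by (subst u(2)[symmetric]) (use u(1) e(1) in \<open>simp add: RG.minus_eq RG.r_distr RG.l_minus RG.r_minus RG.minus_add RG.a_ac\<close>)
  \<comment> \<open>Only the coefficients of \<open>u\<close> on the powers of \<open>g\<close>
    matter. Comparing coefficients at the \<open>n\<close>-th power of \<open>g\<close> in
    \<open>u (1 - e + e^2) = 1\<close> gives the recurrence \<open>rec\<close>.\<close>
  define \<phi> where "\<phi> n = u (g [^]\<^bsub>G\<^esub> n)" for n :: int
  have \<phi>c: "\<phi> n \<in> carrier R" for n
    using g uc by (simp add: \<phi>_def)
  have inj: "g [^]\<^bsub>G\<^esub> m = g [^]\<^bsub>G\<^esub> n \<longleftrightarrow> m = n" for m n :: int
    using G.int_pow_eq[OF g, of m n] ord by auto
  have rec: "\<phi> n \<ominus> \<phi> (n - 1) \<oplus> \<phi> (n - 2) = (if n = 0 then \<one> else \<zero>)" for n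
  proof -
    let ?x = "g [^]\<^bsub>G\<^esub> n"
    have x: "?x \<in> carrier G"
      using g by simp
    have 1: "?x \<otimes>\<^bsub>G\<^esub> inv\<^bsub>G\<^esub> g = g [^]\<^bsub>G\<^esub> (n - 1)"
      using g by (simp add: G.int_pow_diff)
    have 2: "?x \<otimes>\<^bsub>G\<^esub> inv\<^bsub>G\<^esub> (g \<otimes>\<^bsub>G\<^esub> g) = g [^]\<^bsub>G\<^esub> (n - 2)"
      using g G.int_pow_diff[OF g, of n 2] G.int_pow_mult[OF g, of 1 1] by simp
    have "\<one>\<^bsub>RG\<^esub> ?x = (u \<ominus>\<^bsub>RG\<^esub> u \<otimes>\<^bsub>RG\<^esub> e) ?x \<oplus> (u \<otimes>\<^bsub>RG\<^esub> (e \<otimes>\<^bsub>RG\<^esub> e)) ?x"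
      unfolding one using x by (rule RG_add)
    also have "\<dots> = \<phi> n \<ominus> \<phi> (n - 1) \<oplus> \<phi> (n - 2)"
      using x g e(1) u(1) uc unfolding e(2)
      by (simp add: RG_minus \<phi>_def mult_single e_def 1 2 RG_mult_closed single_closed)
    finally have "\<phi> n \<ominus> \<phi> (n - 1) \<oplus> \<phi> (n - 2) = \<one>\<^bsub>RG\<^esub> ?x"
      by simp
    moreover have "?x = \<one>\<^bsub>G\<^esub> \<longleftrightarrow> n = 0"
      using inj[of n 0] by simp
    ultimately show ?thesis
      using x by (simp add: RG_one single_apply)
  qed
  define S where "S = {n. \<phi> n \<noteq> \<zero>}"
  have "(\<lambda>n. g [^]\<^bsub>G\<^esub> n) ` S \<subseteq> supp u"
    using g by (auto simp: S_def \<phi>_def supp_def)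
  then have "finite ((\<lambda>n. g [^]\<^bsub>G\<^esub> n) ` S)"
    using RG_carrierD(3)[OF u(1)] finite_subset by blast
  moreover have "inj_on (\<lambda>n::int. g [^]\<^bsub>G\<^esub> n) S"
    by (rule inj_onI) (simp add: inj)
  ultimately have fin: "finite S"
    using finite_imageD by blast
  have "S \<noteq> {}"
  proof
    assume "S = {}"
    then have "\<phi> n = \<zero>" for n
      by (auto simp: S_def)
    then show False
      using rec[of 0] nontriv by (simp add: R.minus_eq)
  qed
  have out: "\<phi> n = \<zero>" if "n > Max S \<or> n < Min S" for n
    using that Max_ge[OF fin, of n] Min_le[OF fin, of n] by (force simp: S_def)
  have Max: "\<phi> (Max S) \<noteq> \<zero>" "\<phi> (Min S) \<noteq> \<zero>"
    using Max_in[OF fin \<open>S \<noteq> {}\<close>] Min_in[OF fin \<open>S \<noteq> {}\<close>] by (simp_all add: S_def)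
  \<comment> \<open>At \<open>Max S + 2\<close> only the last term of the recurrence survives, and
    at \<open>Min S\<close> only the first. A nonzero left side forces the index to be 0, which
    yields \<open>Max S = -2\<close> and \<open>Min S = 0\<close>.\<close>
  have "Max S = -2"
    using rec[of "Max S + 2"] out[of "Max S + 2"] out[of "1 + Max S"] Max(1) \<phi>c[of "Max S"]
    by (auto simp: R.minus_eq split: if_splits)
  moreover have "Min S = 0"
    using rec[of "Min S"] out[of "Min S - 1"] out[of "Min S - 2"] Max(2) \<phi>c[of "Min S"]
    by (auto simp: R.minus_eq split: if_splits)
  ultimately show False
    using Min_le[OF fin Max_in[OF fin \<open>S \<noteq> {}\<close>]] by simp
qed

lemma single_one_inj:
  assumes "\<one> \<noteq> \<zero>" "g \<in> carrier G" "single \<one> g = single \<one> h"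
  shows "g = h"
  using assms(1,2) fun_cong[OF assms(3), of g] by (simp add: single_apply split: if_splits)

lemma add_pow_single:
  assumes "g \<in> carrier G"
  shows "[(n::nat)] \<cdot>\<^bsub>RG\<^esub> single \<one> g = single ([n] \<cdot> \<one>) g"
proof (induction n)
  case 0
  then show ?case
    by (simp add: single_closed) (auto simp: single_def group_ring_def fun_eq_iff)
next
  case (Suc n)
  have "single ([n] \<cdot> \<one>) g \<oplus>\<^bsub>RG\<^esub> single \<one> g = single ([Suc n] \<cdot> \<one>) g"
    by (rule RG_eqI) (auto intro!: RG_add_closed single_closed simp: RG_add single_apply)
  then show ?case
    using Suc by simp
qed

lemma prime_dvd_ord_in_jacobson:
  assumes nontriv: "\<one> \<noteq> \<zero>" and fine: "generalized_sqrtJ_fine RG"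
    and g: "g \<in> carrier G" and q: "prime q" "q dvd G.ord g" and ord: "G.ord g \<noteq> 0"
  shows "[q] \<cdot> \<one> \<in> jacobson_radical R"
proof (rule ccontr)
  assume not: "[q] \<cdot> \<one> \<notin> jacobson_radical R"
  have "[q] \<cdot> \<one> \<in> Units R"
  proof (rule R.central_unit_of_fine[OF aug.generalized_sqrtJ_fine_image[OF aug_surj fine] _ not])
    show "[q] \<cdot> \<one> \<otimes> x = x \<otimes> [q] \<cdot> \<one>" if "x \<in> carrier R" for x
      using that by (simp add: R.add_pow_ldistr R.add_pow_rdistr)
  qed simp
  then obtain v where v: "v \<in> carrier R" "v \<otimes> [q] \<cdot> \<one> = \<one>" "[q] \<cdot> \<one> \<otimes> v = \<one>"
    using R.Units_l_inv R.Units_r_inv R.Units_inv_closed by metis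
  have unit: "[q] \<cdot>\<^bsub>RG\<^esub> \<one>\<^bsub>RG\<^esub> \<in> Units RG"
    unfolding RG_one add_pow_single[OF G.one_closed] using v
    by (intro RG.Units_intro[of _ "single v \<one>\<^bsub>G\<^esub>" "single v \<one>\<^bsub>G\<^esub>"])
      (auto simp: single_closed single_mult_single RG_one)
  \<comment> \<open>This power of \<open>g\<close> has order \<open>q\<close>. Since
    \<open>h\<close> minus 1 has augmentation zero it is radical, and with \<open>q\<close>
    invertible in \<open>RG\<close> the root-of-unity argument collapses \<open>h\<close> to the
    identity.\<close>
  define h where "h = g [^]\<^bsub>G\<^esub> (G.ord g div q)"
  have h: "h \<in> carrier G"
    using g by (simp add: h_def)
  have "h [^]\<^bsub>G\<^esub> q = g [^]\<^bsub>G\<^esub> (G.ord g)"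
    using g q(2) by (simp add: h_def G.nat_pow_pow)
  then have hq: "h [^]\<^bsub>G\<^esub> q = \<one>\<^bsub>G\<^esub>"
    using g G.pow_ord_eq_1 by simp
  have "single \<one> h = \<one>\<^bsub>RG\<^esub>"
  proof (rule RG.root_of_unity_in_one_plus_jacobson[OF _ _ _ unit])
    show "single \<one> h \<in> carrier RG"
      by (simp add: single_closed)
    then show "single \<one> h \<ominus>\<^bsub>RG\<^esub> \<one>\<^bsub>RG\<^esub> \<in> jacobson_radical RG"
      using h by (intro aug.kernel_in_jacobson_radical[OF aug_surj fine nontriv] single_minus_one_augmentation) auto
    show "single \<one> h [^]\<^bsub>RG\<^esub> q = \<one>\<^bsub>RG\<^esub>"
      using h hq by (simp add: single_pow RG_one)
  qed
  then have "h = \<one>\<^bsub>G\<^esub>"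
    using single_one_inj[OF nontriv h] by (simp add: RG_one)
  then have "G.ord g dvd G.ord g div q"
    using g G.pow_eq_id by (simp add: h_def)
  moreover have "0 < G.ord g div q" "G.ord g div q < G.ord g"
    using q ord prime_gt_1_nat[OF q(1)] by (auto simp: dvd_div_eq_0_iff elim!: dvdE)
  ultimately show False
    using dvd_imp_le by fastforce
qed

text \<open>One nontrivial element supplies a prime \<open>p\<close> in the radical. A different
  prime dividing the order of any element would lie there as well, against coprimality.\<close>

lemma p_group_of_fine:
  assumes nontriv: "\<one> \<noteq> \<zero>" and fine: "generalized_sqrtJ_fine RG"
  shows "\<exists>p::nat. prime p \<and> p_group p G \<and>
    (carrier G \<noteq> {\<one>\<^bsub>G\<^esub>} \<longrightarrow> [p] \<cdot> \<one> \<in> jacobson_radical R)"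
proof (cases "carrier G = {\<one>\<^bsub>G\<^esub>}")
  case True
  \<comment> \<open>The trivial group is a \<open>p\<close>-group for every prime; 2 is an arbitrary
    choice.\<close>
  then have "p_group 2 G"
    by (auto simp: p_group_def intro: exI[of _ 0])
  then show ?thesis
    using True two_is_prime_nat by blast
next
  case False
  have ord: "G.ord g \<noteq> 0" if "g \<in> carrier G" for g
    using that single_closed
    by (intro finite_order_of_jacobson[OF nontriv] aug.kernel_in_jacobson_radical[OF aug_surj fine nontriv]
        single_minus_one_augmentation) auto
  note inJ = prime_dvd_ord_in_jacobson[OF nontriv fine]
  obtain g where g: "g \<in> carrier G" "g \<noteq> \<one>\<^bsub>G\<^esub>"
    using False G.one_closed by blast
  then obtain p where p: "prime p" "p dvd G.ord g"
    using G.ord_eq_1 prime_factor_nat by metis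
  have pJ: "[p] \<cdot> \<one> \<in> jacobson_radical R"
    using inJ g(1) p ord by blast
  have "\<exists>k. G.ord x = p ^ k" if x: "x \<in> carrier G" for x
  proof -
    have "q = p" if q: "prime q" "q dvd G.ord x" for q
    proof (rule ccontr)
      assume "q \<noteq> p"
      then have "coprime p q"
        using p(1) q(1) primes_coprime by blast
      then show False
        using R.coprime_in_jacobson_trivial[of p q] pJ inJ[OF x q ord[OF x]] nontriv p(1)
        by (auto simp: prime_nat_iff)
    qed
    moreover obtain m where m: "G.ord x = p ^ multiplicity p (G.ord x) * m" "\<not> p dvd m"
      using multiplicity_decompose'[of "G.ord x" p] ord[OF x] p(1) not_prime_unit by blast
    ultimately have "m = 1"
      using prime_factor_nat[of m] by (metis dvd_mult)
    then have "G.ord x = p ^ multiplicity p (G.ord x)"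
      using m(1) by simp
    then show ?thesis
      by blast
  qed
  then show ?thesis
    using p(1) pJ by (auto simp: p_group_def)
qed

end

section \<open>Sufficiency for finite groups\<close>

lemma (in group) p_group_order:
  assumes fin: "finite (carrier G)" and p: "prime p" "p_group p G"
  shows "\<exists>a. order G = p ^ a"
proof -
  have "order G \<noteq> 0"
    using fin order_gt_0_iff_finite by simp
  then obtain m where m: "order G = p ^ multiplicity p (order G) * m" "\<not> p dvd m"
    using multiplicity_decompose'[of "order G" p] p(1) not_prime_unit by blast
  have "m = 1"
  proof (rule ccontr)
    assume "m \<noteq> 1"
    then obtain q where q: "prime q" "q dvd m"
      using prime_factor_nat by blast
    then have "q dvd order G"
      using m(1) by (metis dvd_mult)
    \<comment> \<open>This is Cauchy's theorem, obtained as Sylow's theorem at exponent 1.\<close>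
    then obtain H where H: "subgroup H G" "card H = q"
      using sylow_thm[of q G 1] q(1) fin is_group by (auto elim!: dvdE)
    have "H \<noteq> {\<one>}"
      using H(2) q(1) by (auto simp: prime_nat_iff)
    then obtain x where x: "x \<in> H" "x \<noteq> \<one>"
      using subgroup.one_closed[OF H(1)] by blast
    have xG: "x \<in> carrier G"
      using x(1) subgroup.subset[OF H(1)] by blast
    interpret H: group "G\<lparr>carrier := H\<rparr>"
      using H(1) is_group by (rule subgroup.subgroup_is_group)
    have "x [^] q = \<one>"
      using H.pow_order_eq_1[of x] x(1) H(2) by (simp add: order_def flip: nat_pow_consistent)
    then have "ord x dvd q"
      using pow_eq_id[OF xG] by blast
    moreover obtain k where k: "ord x = p ^ k"
      using p(2) xG by (auto simp: p_group_def)
    moreover have "p dvd p ^ k"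
      using k x(2) ord_eq_1[OF xG] by (intro dvd_power) (auto intro: gr0I)
    ultimately have "p dvd q"
      by (metis dvd_trans)
    then have "p = q"
      using p(1) q(1) primes_dvd_imp_eq by blast
    then show False
      using q(2) m(2) by simp
  qed
  then show ?thesis
    using m(1) by auto
qed

text \<open>\<open>BijGroup\<close> consists of extensional bijections, hence the restriction to
  \<open>E\<close>. Bijectivity comes from the action of the inverse element.\<close>

lemma (in group) group_actionI:
  assumes closed: "\<And>g x. g \<in> carrier G \<Longrightarrow> x \<in> E \<Longrightarrow> \<phi> g x \<in> E"
    and one: "\<And>x. x \<in> E \<Longrightarrow> \<phi> \<one> x = x"
    and mult: "\<And>g h x. g \<in> carrier G \<Longrightarrow> h \<in> carrier G \<Longrightarrow> x \<in> E \<Longrightarrow> \<phi> (g \<otimes> h) x = \<phi> g (\<phi> h x)"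
  shows "group_action G E (\<lambda>g. restrict (\<phi> g) E)"
proof -
  have bij: "restrict (\<phi> g) E \<in> Bij E" if g: "g \<in> carrier G" for g
  proof -
    have "bij_betw (\<phi> g) E E"
    proof (rule bij_betw_byWitness[where f' = "\<phi> (inv g)"])
      show "\<forall>x\<in>E. \<phi> (inv g) (\<phi> g x) = x" "\<forall>x\<in>E. \<phi> g (\<phi> (inv g) x) = x"
        using g one mult[of g "inv g"] mult[of "inv g" g] by simp_all
      show "\<phi> g ` E \<subseteq> E" "\<phi> (inv g) ` E \<subseteq> E"
        using g closed by auto
    qed
    then have "bij_betw (restrict (\<phi> g) E) E E"
      by (simp cong: bij_betw_cong)
    then show ?thesis
      by (simp add: Bij_def)
  qed
  have "(\<lambda>g. restrict (\<phi> g) E) \<in> hom G (BijGroup E)"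
  proof (rule homI)
    show "restrict (\<phi> g) E \<in> carrier (BijGroup E)" if "g \<in> carrier G" for g
      using bij[OF that] by (simp add: BijGroup_def)
    fix g h assume gh: "g \<in> carrier G" "h \<in> carrier G"
    show "restrict (\<phi> (g \<otimes> h)) E = restrict (\<phi> g) E \<otimes>\<^bsub>BijGroup E\<^esub> restrict (\<phi> h) E"
      using gh bij mult closed by (auto simp: BijGroup_def compose_def fun_eq_iff)
  qed
  then show ?thesis
    by (intro group_action.intro group_hom.intro group_hom_axioms.intro is_group group_BijGroup)
qed

text \<open>Orbit sizes are powers of \<open>p\<close>. If \<open>x0\<close> were the only fixed
  point, all other orbits would have size divisible by \<open>p\<close>, and \<open>card E\<close>
  would be 1 modulo \<open>p\<close>.\<close>

lemma (in group_action) p_group_fixed_point: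
  assumes p: "prime p" "order G = p ^ a" and fin: "finite E" and dvd: "p dvd card E"
    and x0: "x0 \<in> E" "\<And>g. g \<in> carrier G \<Longrightarrow> \<phi> g x0 = x0"
  shows "\<exists>x \<in> E. x \<noteq> x0 \<and> (\<forall>g \<in> carrier G. \<phi> g x = x)"
proof (rule ccontr)
  assume not: "\<not> ?thesis"
  interpret G: group G
    using group_hom by (rule group_hom.axioms(1))
  have finO: "finite (orbits G E \<phi>)"
    using fin by (auto simp: orbits_def)
  have one: "orbit G \<phi> x0 = {x0}"
    using x0(2) by (auto simp: orbit_def intro!: exI[of _ \<one>])
  have x0O: "{x0} \<in> orbits G E \<phi>"
    using one x0(1) by (auto simp: orbits_def)
  have "p dvd card orb" if orb: "orb \<in> orbits G E \<phi> - {{x0}}" for orb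
  proof -
    obtain x where x: "x \<in> E" "orb = orbit G \<phi> x"
      using orb by (auto simp: orbits_def)
    have "x \<in> orb"
      using x orbit_refl by blast
    have "card orb dvd p ^ a"
      using orbit_stabilizer_theorem[OF x(1)] x(2) p(2) by (metis dvd_triv_left)
    then obtain k where k: "card orb = p ^ k"
      using p(1) divides_primepow_nat by blast
    have "k \<noteq> 0"
    proof
      assume "k = 0"
      then have "orb = {x}"
        using k \<open>x \<in> orb\<close> by (auto simp: card_1_singleton_iff)
      then have "\<forall>g \<in> carrier G. \<phi> g x = x"
        using x(2) by (auto simp: orbit_def)
      then show False
        using not x(1) orb \<open>orb = {x}\<close> by auto
    qed
    then show ?thesis
      using k by simp
  qed
  then have "p dvd (\<Sum>orb\<in>orbits G E \<phi> - {{x0}}. card orb)"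
    by (intro dvd_sum)
  moreover have "card E = 1 + (\<Sum>orb\<in>orbits G E \<phi> - {{x0}}. card orb)"
    using disjoint_sum[OF fin, of "\<lambda>_. 1::nat"] sum.remove[OF finO x0O, of card] by simp
  ultimately have "p dvd 1"
    using dvd by (metis dvd_add_left_iff)
  then show False
    using p(1) by simp
qed

text \<open>The element \<open>t\<close> has order exactly \<open>p\<close>, so Lagrange's theorem
  applies.\<close>

lemma (in group) prime_dvd_card_subgroup:
  assumes E: "subgroup E G" and t: "t \<in> E" "t \<noteq> \<one>" "t [^] p = \<one>" and p: "prime (p::nat)"
  shows "p dvd card E"
proof -
  have tG: "t \<in> carrier G"
    using E t(1) subgroup.subset by blast
  interpret E: group "G\<lparr>carrier := E\<rparr>"
    using E is_group by (rule subgroup.subgroup_is_group)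
  have "ord t = p"
    using t p tG pow_eq_id[OF tG, of p] ord_eq_1[OF tG] by (auto simp: prime_nat_iff)
  moreover have "t [^] card E = \<one>"
    using E.pow_order_eq_1[of t] t(1) by (simp add: order_def flip: nat_pow_consistent)
  ultimately show ?thesis
    using pow_eq_id[OF tG] by blast
qed

lemma (in ring) left_ideal_finsum:
  assumes I: "left_ideal I R" and "\<And>a. a \<in> A \<Longrightarrow> f a \<in> I"
  shows "(\<Oplus>a\<in>A. f a) \<in> I"
  using assms(2)
proof (induction A rule: infinite_finite_induct)
  case (insert a A)
  then show ?case
    using left_idealD(1)[OF I] by (subst finsum_insert) (auto intro!: left_idealD(3)[OF I])
qed (auto simp: left_idealD(2)[OF I])

section \<open>\<open>RG\<close> as a left \<open>R\<close>-module and Nakayama's lemma\<close>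

context ring_and_group
begin

text \<open>The \<open>R\<close>-module structure is expressed by ring multiplication inside
  \<open>RG\<close>, so every left ideal is automatically a submodule.\<close>

abbreviation scale :: "'r \<Rightarrow> ('g \<Rightarrow> 'r) \<Rightarrow> 'g \<Rightarrow> 'r"
  where "scale r f \<equiv> single r \<one>\<^bsub>G\<^esub> \<otimes>\<^bsub>RG\<^esub> f"

lemma scale_apply:
  "r \<in> carrier R \<Longrightarrow> f \<in> carrier RG \<Longrightarrow> x \<in> carrier G \<Longrightarrow> scale r f x = r \<otimes> f x"
  by (simp add: single_mult)

lemma fun_upd_zero_closed:
  assumes f: "f \<in> carrier RG" and t: "t \<in> carrier G"
  shows "f(t := \<zero>) \<in> carrier RG" "supp (f(t := \<zero>)) = supp f - {t}"
proof -
  show eq: "supp (f(t := \<zero>)) = supp f - {t}"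
    by (auto simp: supp_def)
  show "f(t := \<zero>) \<in> carrier RG"
    using RG_carrierD[OF f] t eq by (intro RG_carrierI) auto
qed

lemma split_coefficient:
  assumes f: "f \<in> carrier RG" and t: "t \<in> carrier G"
  shows "f = single (f t) t \<oplus>\<^bsub>RG\<^esub> f(t := \<zero>)"
  using RG_carrierD(1)[OF f] t f fun_upd_zero_closed[OF f t]
  by (intro RG_eqI RG_add_closed) (auto simp: single_closed RG_add single_apply)

lemma empty_supp:
  assumes "f \<in> carrier RG" "supp f = {}"
  shows "f = \<zero>\<^bsub>RG\<^esub>"
  using assms by (intro RG_eqI) (auto simp: supp_def RG_zero)

lemma RG_induct [consumes 1, case_names zero add]:
  assumes f: "f \<in> carrier RG"
    and zero: "P \<zero>\<^bsub>RG\<^esub>"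
    and add: "\<And>r g h. r \<in> carrier R \<Longrightarrow> g \<in> carrier G \<Longrightarrow> h \<in> carrier RG \<Longrightarrow> P h \<Longrightarrow> P (single r g \<oplus>\<^bsub>RG\<^esub> h)"
  shows "P f"
proof -
  have "\<forall>f \<in> carrier RG. supp f = T \<longrightarrow> P f" if "finite T" for T
    using that
  proof induction
    case empty
    then show ?case
      using empty_supp zero by auto
  next
    case (insert t T)
    show ?case
    proof (intro ballI impI)
      fix f assume f: "f \<in> carrier RG" "supp f = insert t T"
      have t: "t \<in> carrier G"
        using f(2) supp_subset by blast
      have "P (f(t := \<zero>))"
        using insert fun_upd_zero_closed[OF f(1) t] f(2) by auto
      then have "P (single (f t) t \<oplus>\<^bsub>RG\<^esub> f(t := \<zero>))"
        using add[OF RG_carrierD(1)[OF f(1) t] t] fun_upd_zero_closed[OF f(1) t] by blast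
      then show "P f"
        using split_coefficient[OF f(1) t] by simp
    qed
  qed
  then show ?thesis
    using f RG_carrierD(3)[OF f] by blast
qed

text \<open>The group ring \<open>J(R)G\<close> viewed inside \<open>RG\<close>.\<close>

definition radical_coefficients :: "('g \<Rightarrow> 'r) set"
  where "radical_coefficients = {f \<in> carrier RG. \<forall>x \<in> carrier G. f x \<in> jacobson_radical R}"

lemma left_ideal_radical_coefficients: "left_ideal radical_coefficients RG"
proof (rule RG.left_idealI)
  show "radical_coefficients \<subseteq> carrier RG"
    by (auto simp: radical_coefficients_def)
  show "\<zero>\<^bsub>RG\<^esub> \<in> radical_coefficients"
    using R.jacobson_radicalD(2) by (simp add: radical_coefficients_def RG_zero)
  show "f \<oplus>\<^bsub>RG\<^esub> h \<in> radical_coefficients"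
    if "f \<in> radical_coefficients" "h \<in> radical_coefficients" for f h
    using that R.jacobson_radicalD(3) by (simp add: radical_coefficients_def RG_add)
  show "f \<otimes>\<^bsub>RG\<^esub> h \<in> radical_coefficients"
    if f: "f \<in> carrier RG" and h: "h \<in> radical_coefficients" for f h
  proof -
    have hc: "h \<in> carrier RG" "\<And>x. x \<in> carrier G \<Longrightarrow> h x \<in> jacobson_radical R"
      using h by (auto simp: radical_coefficients_def)
    have "(f \<otimes>\<^bsub>RG\<^esub> h) x \<in> jacobson_radical R" if x: "x \<in> carrier G" for x
      unfolding RG_mult_eq[OF f hc(1) x RG_carrierD(3)[OF f] order.refl supp_subset]
      using x supp_subset[of f] RG_carrierD(1)[OF f] hc(2)
      by (intro R.left_ideal_finsum[OF R.left_ideal_jacobson_radical] R.jacobson_radicalD(6)) auto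
    then show ?thesis
      using f hc by (simp add: radical_coefficients_def)
  qed
qed

text \<open>Nakayama's lemma for the finitely generated left \<open>R\<close>-module \<open>RG\<close>: the generators in \<open>T\<close>
  are eliminated one at a time.\<close>

lemma eliminate_generators:
  assumes M: "left_ideal M RG" and T: "finite T" "T \<subseteq> carrier G"
    and span: "\<And>s. s \<in> carrier RG \<Longrightarrow>
      \<exists>m \<in> M. \<exists>j \<in> radical_coefficients. supp j \<subseteq> T \<and> s = m \<oplus>\<^bsub>RG\<^esub> j"
  shows "\<one>\<^bsub>RG\<^esub> \<in> M"
  using T span
proof (induction T rule: finite_induct)
  case empty
  obtain m j where mj: "m \<in> M" "j \<in> radical_coefficients" "supp j \<subseteq> {}" "\<one>\<^bsub>RG\<^esub> = m \<oplus>\<^bsub>RG\<^esub> j"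
    using empty(2)[OF RG.one_closed] by blast
  have "j = \<zero>\<^bsub>RG\<^esub>"
    using mj by (intro empty_supp) (auto simp: radical_coefficients_def)
  then show ?case
    using mj RG.left_idealD(1)[OF M] by auto
next
  case (insert t T)
  note MD = RG.left_idealD[OF M]
  note JD = RG.left_idealD[OF left_ideal_radical_coefficients]
  have t: "t \<in> carrier G"
    using insert.prems by blast
  have split: "\<exists>j' \<in> radical_coefficients. supp j' \<subseteq> T \<and> j = single (j t) t \<oplus>\<^bsub>RG\<^esub> j'"
    if "j \<in> radical_coefficients" "supp j \<subseteq> insert t T" for j
  proof (intro bexI conjI)
    have j: "j \<in> carrier RG"
      using that(1) by (simp add: radical_coefficients_def)
    show "j = single (j t) t \<oplus>\<^bsub>RG\<^esub> j(t := \<zero>)"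
      by (rule split_coefficient[OF j t])
    show "supp (j(t := \<zero>)) \<subseteq> T"
      using fun_upd_zero_closed(2)[OF j t] that(2) by blast
    show "j(t := \<zero>) \<in> radical_coefficients"
      using that(1) fun_upd_zero_closed(1)[OF j t] R.jacobson_radicalD(2)
      by (simp add: radical_coefficients_def)
  qed
  have supp_scale: "supp (scale r j) \<subseteq> T"
    if "r \<in> carrier R" "j \<in> carrier RG" "supp j \<subseteq> T" for r j
    using that by (auto simp: supp_def scale_apply)
  have scale: "scale r (single s t) = single (r \<otimes> s) t" if "r \<in> carrier R" "s \<in> carrier R" for r s
    using that t by (simp add: single_mult_single)
  \<comment> \<open>The generator \<open>t\<close> is expressed through \<open>M\<close> and the
    remaining generators: in \<open>t = m + (j t) t + j'\<close> the middle term is moved to the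
    left, and \<open>1 - j t\<close> has a left inverse because \<open>j t\<close> is
    radical.\<close>
  have "\<exists>m \<in> M. \<exists>j \<in> radical_coefficients. supp j \<subseteq> T \<and> single \<one> t = m \<oplus>\<^bsub>RG\<^esub> j"
  proof -
    obtain m j where mj: "m \<in> M" "j \<in> radical_coefficients" "supp j \<subseteq> insert t T"
      "single \<one> t = m \<oplus>\<^bsub>RG\<^esub> j"
      using insert.prems(2)[OF single_closed[OF R.one_closed, of t]] by blast
    obtain j' where j': "j' \<in> radical_coefficients" "supp j' \<subseteq> T"
      "j = single (j t) t \<oplus>\<^bsub>RG\<^esub> j'"
      using split[OF mj(2,3)] by blast
    have jt: "j t \<in> jacobson_radical R" "j t \<in> carrier R"
      using mj(2) t RG_carrierD(1) by (auto simp: radical_coefficients_def)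
    then obtain r where r: "r \<in> carrier R" "r \<otimes> (\<one> \<ominus> j t) = \<one>"
      using R.one_minus_jacobson_left_inverse by blast
    have mc: "m \<in> carrier RG" and jc: "j' \<in> carrier RG"
      using MD(1) mj(1) j'(1) by (auto simp: radical_coefficients_def)
    have "single (\<one> \<ominus> j t) t = single \<one> t \<ominus>\<^bsub>RG\<^esub> single (j t) t"
      using jt by (intro RG_eqI) (auto simp: single_closed RG_minus single_apply R.minus_eq)
    also have "\<dots> = m \<oplus>\<^bsub>RG\<^esub> j'"
      unfolding mj(4) using mc jc jt
      by (subst j'(3)) (simp add: RG.minus_eq single_closed RG.a_ac RG.r_neg1 RG.r_neg2 RG.r_neg)
    finally have "scale r (single (\<one> \<ominus> j t) t) = scale r m \<oplus>\<^bsub>RG\<^esub> scale r j'"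
      using mc jc r(1) by (simp add: RG.r_distr single_closed)
    then have "single \<one> t = scale r m \<oplus>\<^bsub>RG\<^esub> scale r j'"
      using scale[of r "\<one> \<ominus> j t"] r jt by simp
    moreover have "scale r m \<in> M" "scale r j' \<in> radical_coefficients"
      using r(1) mj(1) j'(1) by (auto intro: MD JD single_closed)
    ultimately show ?thesis
      using supp_scale[OF r(1) jc j'(2)] by blast
  qed
  then obtain m1 j1 where e: "m1 \<in> M" "j1 \<in> radical_coefficients" "supp j1 \<subseteq> T"
    "single \<one> t = m1 \<oplus>\<^bsub>RG\<^esub> j1"
    by blast
  show ?case
  proof (rule insert.IH)
    show "T \<subseteq> carrier G"
      using insert.prems by blast
    fix s assume "s \<in> carrier RG"
    then obtain m j where mj: "m \<in> M" "j \<in> radical_coefficients" "supp j \<subseteq> insert t T"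
      "s = m \<oplus>\<^bsub>RG\<^esub> j"
      using insert.prems(2) by blast
    obtain j' where j': "j' \<in> radical_coefficients" "supp j' \<subseteq> T"
      "j = single (j t) t \<oplus>\<^bsub>RG\<^esub> j'"
      using split[OF mj(2,3)] by blast
    have jt: "j t \<in> carrier R"
      using mj(2) t RG_carrierD(1) by (auto simp: radical_coefficients_def)
    have c: "m \<in> carrier RG" "j' \<in> carrier RG" "m1 \<in> carrier RG" "j1 \<in> carrier RG"
      using MD(1) mj(1) j'(1) e(1,2) by (auto simp: radical_coefficients_def)
    \<comment> \<open>Substituting the expression for \<open>t\<close> removes it from an arbitrary
      element \<open>s\<close>, so the spanning hypothesis holds for \<open>T\<close> alone.\<close>
    have "single (j t) t = scale (j t) m1 \<oplus>\<^bsub>RG\<^esub> scale (j t) j1"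
      using scale[OF jt R.one_closed] e(4) c jt by (simp add: RG.r_distr single_closed)
    then have "s = (m \<oplus>\<^bsub>RG\<^esub> scale (j t) m1) \<oplus>\<^bsub>RG\<^esub> (j' \<oplus>\<^bsub>RG\<^esub> scale (j t) j1)"
      unfolding mj(4) using c jt by (subst j'(3)) (simp add: single_closed RG.a_ac)
    moreover have "m \<oplus>\<^bsub>RG\<^esub> scale (j t) m1 \<in> M"
      using mj(1) e(1) jt by (intro MD single_closed)
    moreover have "j' \<oplus>\<^bsub>RG\<^esub> scale (j t) j1 \<in> radical_coefficients"
      using j'(1) e(2) jt by (intro JD single_closed)
    moreover have "supp (j' \<oplus>\<^bsub>RG\<^esub> scale (j t) j1) \<subseteq> T"
    proof -
      have "supp (j' \<oplus>\<^bsub>RG\<^esub> scale (j t) j1) \<subseteq> supp j' \<union> supp (scale (j t) j1)"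
        by (auto simp: supp_def RG_add)
      then show ?thesis
        using j'(2) supp_scale[OF jt c(4) e(3)] by blast
    qed
    ultimately show "\<exists>m \<in> M. \<exists>j \<in> radical_coefficients. supp j \<subseteq> T \<and> s = m \<oplus>\<^bsub>RG\<^esub> j"
      by blast
  qed
qed

text \<open>Otherwise maximality gives \<open>RG = M + J(R)G\<close>. For finite \<open>G\<close>
  the group elements are finitely many generators, and eliminating all of them puts 1 into
  \<open>M\<close>.\<close>

lemma radical_coefficients_subset_maximal:
  assumes fin: "finite (carrier G)" and M: "maximal_left_ideal M RG"
  shows "radical_coefficients \<subseteq> M"
proof (rule ccontr)
  assume not: "\<not> ?thesis"
  have "\<one>\<^bsub>RG\<^esub> \<in> M"
  proof (rule eliminate_generators[OF RG.maximal_left_idealD(1)[OF M] fin order.refl])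
    fix s assume "s \<in> carrier RG"
    then show "\<exists>m \<in> M. \<exists>j \<in> radical_coefficients. supp j \<subseteq> carrier G \<and> s = m \<oplus>\<^bsub>RG\<^esub> j"
      using RG.maximal_left_ideal_sum[OF M left_ideal_radical_coefficients not] supp_subset by metis
  qed
  then show False
    using RG.maximal_left_idealD(2)[OF M] by blast
qed

text \<open>The cosets of \<open>M\<close> that are represented by integral combinations of group elements form a
  finite elementary abelian \<open>p\<close>-group on which \<open>G\<close> acts, so the number of fixed cosets is
  divisible by \<open>p\<close>.\<close>

lemma fixed_coset_exists:
  assumes fin: "finite (carrier G)" and p: "prime p" "p_group p G"
    and pJ: "[p] \<cdot> \<one> \<in> jacobson_radical R" and M: "maximal_left_ideal M RG"
  shows "\<exists>w \<in> carrier RG. w \<notin> M \<and> (\<forall>g \<in> carrier G. single \<one> g \<otimes>\<^bsub>RG\<^esub> w \<ominus>\<^bsub>RG\<^esub> w \<in> M)"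
proof -
  note lM = RG.maximal_left_idealD(1)[OF M]
  note MD = RG.left_idealD[OF lM]
  have Mc: "m \<in> carrier RG" if "m \<in> M" for m
    using MD(1) that by blast
  have subM: "subgroup M (add_monoid RG)"
    using lM by (simp add: left_ideal_def additive_subgroup_def)
  interpret N: normal M "add_monoid RG"
    using subM by (rule RG.add.subgroup_imp_normal)
  define Q where "Q = add_monoid RG Mod M"
  interpret Q: group Q
    unfolding Q_def by (rule N.factorgroup_is_group)
  define C where "C f = M #>\<^bsub>add_monoid RG\<^esub> f" for f
  have C_iff: "h \<in> C f \<longleftrightarrow> (\<exists>m \<in> M. h = m \<oplus>\<^bsub>RG\<^esub> f)" for f h
    by (auto simp: C_def r_coset_def)
  have C_eq: "C f = C h \<longleftrightarrow> f \<ominus>\<^bsub>RG\<^esub> h \<in> M" if f: "f \<in> carrier RG" and h: "h \<in> carrier RG" for f h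
  proof
    assume "C f = C h"
    then have "f \<in> C h"
      using RG.add.rcos_self[OF _ subM, of f] f by (simp add: C_def)
    then obtain m where "m \<in> M" "f = m \<oplus>\<^bsub>RG\<^esub> h"
      using C_iff by blast
    then show "f \<ominus>\<^bsub>RG\<^esub> h \<in> M"
      using h Mc by (simp add: RG.minus_eq RG.a_assoc RG.r_neg)
  next
    assume "f \<ominus>\<^bsub>RG\<^esub> h \<in> M"
    moreover have "f = (f \<ominus>\<^bsub>RG\<^esub> h) \<oplus>\<^bsub>RG\<^esub> h"
      using f h by (simp add: RG.minus_eq RG.a_assoc RG.l_neg)
    ultimately have "f \<in> C h"
      using C_iff by blast
    then show "C f = C h"
      using RG.add.repr_independence[OF _ _ subM] h unfolding C_def by simp
  qed
  \<comment> \<open>Natural coefficients suffice: multiples of \<open>p\<close> vanish modulo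
    \<open>M\<close>, so \<open>p - 1\<close> serves as -1.\<close>
  define c where "c n = (\<lambda>x \<in> carrier G. [n x] \<cdot> \<one>)" for n :: "'g \<Rightarrow> nat"
  have finsupp: "finite (supp f)" for f
    using fin supp_subset finite_subset by blast
  have c_closed: "c n \<in> carrier RG" for n
    using finsupp by (intro RG_carrierI) (auto simp: c_def)
  have c_apply: "c n x = [n x] \<cdot> \<one>" if "x \<in> carrier G" for n x
    using that by (simp add: c_def)
  have c_add: "c n \<oplus>\<^bsub>RG\<^esub> c m = c (\<lambda>x. n x + m x)" for n m
    using c_closed by (intro RG_eqI RG_add_closed) (auto simp: RG_add c_apply R.add.nat_pow_mult)
  have c_zero: "c (\<lambda>x. 0) = \<zero>\<^bsub>RG\<^esub>"
    using c_closed by (intro RG_eqI) (auto simp: RG_zero c_apply)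
  have c_multiple: "c (\<lambda>x. n x * p) \<in> M" for n
  proof -
    have "c (\<lambda>x. n x * p) \<in> radical_coefficients"
      using c_closed R.add_pow_mult_jacobson[OF pJ] by (simp add: radical_coefficients_def c_apply)
    then show ?thesis
      using radical_coefficients_subset_maximal[OF fin M] by blast
  qed
  have C_add: "C f \<otimes>\<^bsub>Q\<^esub> C h = C (f \<oplus>\<^bsub>RG\<^esub> h)" if "f \<in> carrier RG" "h \<in> carrier RG" for f h
    using that N.rcos_sum[of f h] by (simp add: Q_def FactGroup_def C_def)
  have C_zero: "C \<zero>\<^bsub>RG\<^esub> = M"
    using RG.add.coset_mult_one[of M] MD(1) by (simp add: C_def)
  have C_M: "C f = M" if "f \<in> M" for f
    using C_eq[of f "\<zero>\<^bsub>RG\<^esub>"] that Mc[OF that] C_zero by (simp add: RG.minus_eq)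
  define E where "E = range (\<lambda>n. C (c n))"
  have "finite E"
  proof (rule finite_subset)
    show "E \<subseteq> (\<lambda>n. C (c n)) ` (carrier G \<rightarrow>\<^sub>E {..<p})"
    proof
      fix X assume "X \<in> E"
      then obtain n where X: "X = C (c n)"
        by (auto simp: E_def)
      \<comment> \<open>Reducing every coefficient modulo \<open>p\<close> does not change the
        coset, which leaves finitely many choices since \<open>G\<close> is finite.\<close>
      let ?r = "\<lambda>x \<in> carrier G. n x mod p"
      have "c n = c (\<lambda>x. n x div p * p) \<oplus>\<^bsub>RG\<^esub> c ?r"
        unfolding c_add by (auto simp: c_def)
      then have "c n \<ominus>\<^bsub>RG\<^esub> c ?r = c (\<lambda>x. n x div p * p)"
        using c_closed by (simp add: RG.minus_eq RG.a_assoc RG.r_neg)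
      then have "C (c n) = C (c ?r)"
        using C_eq c_closed c_multiple by simp
      moreover have "?r \<in> carrier G \<rightarrow>\<^sub>E {..<p}"
        using prime_gt_0_nat[OF p(1)] by auto
      ultimately show "X \<in> (\<lambda>n. C (c n)) ` (carrier G \<rightarrow>\<^sub>E {..<p})"
        unfolding X by (rule image_eqI)
    qed
  qed (use fin in \<open>auto intro: finite_PiE\<close>)
  have one_Q: "\<one>\<^bsub>Q\<^esub> = M"
    by (simp add: Q_def FactGroup_def)
  have ME: "M \<in> E"
    unfolding E_def using C_zero c_zero by (intro range_eqI[of _ _ "\<lambda>x. 0"]) simp
  have subE: "E \<subseteq> carrier Q"
    using c_closed by (auto simp: E_def C_def Q_def FactGroup_def RCOSETS_def)
  have "subgroup E Q"
  proof (rule Q.subgroupI)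
    show "E \<subseteq> carrier Q" "E \<noteq> {}"
      using subE ME by auto
    fix X assume "X \<in> E"
    then obtain n where X: "X = C (c n)"
      by (auto simp: E_def)
    \<comment> \<open>The sum of \<open>(p - 1) n\<close> and \<open>n\<close> is
      \<open>n p\<close>, which lies in \<open>M\<close>; hence this coset is the additive
      inverse.\<close>
    let ?Y = "C (c (\<lambda>x. (p - 1) * n x))"
    have "(p - 1) * k + k = k * p" for k
      using prime_gt_0_nat[OF p(1)] by (cases p) auto
    then have "?Y \<otimes>\<^bsub>Q\<^esub> X = \<one>\<^bsub>Q\<^esub>"
      unfolding X one_Q using C_M[OF c_multiple[of n]] by (simp add: C_add c_closed c_add)
    then have "inv\<^bsub>Q\<^esub> X = ?Y"
      using \<open>X \<in> E\<close> subE by (intro Q.inv_equality) (auto simp: E_def)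
    then show "inv\<^bsub>Q\<^esub> X \<in> E"
      by (simp add: E_def)
    fix Y assume "Y \<in> E"
    then obtain m where "Y = C (c m)"
      by (auto simp: E_def)
    then show "X \<otimes>\<^bsub>Q\<^esub> Y \<in> E"
      unfolding X by (simp add: C_add c_closed c_add E_def)
  qed
  \<comment> \<open>The coset of 1 is the element of order \<open>p\<close> needed for
    \<open>p\<close> to divide \<open>card E\<close>: it is nonzero because a maximal left ideal
    omits 1.\<close>
  moreover define \<delta> where "\<delta> x = (if x = \<one>\<^bsub>G\<^esub> then 1 else 0 :: nat)" for x
  have "c \<delta> = \<one>\<^bsub>RG\<^esub>"
    using c_closed by (intro RG_eqI) (auto simp: RG_one single_apply c_apply \<delta>_def single_closed)
  then have "C (c \<delta>) \<noteq> \<one>\<^bsub>Q\<^esub>"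
    using C_eq[of "\<one>\<^bsub>RG\<^esub>" "\<zero>\<^bsub>RG\<^esub>"] RG.maximal_left_idealD(2)[OF M]
    by (simp add: one_Q C_zero RG.minus_eq)
  moreover have pow: "C (c n) [^]\<^bsub>Q\<^esub> (k::nat) = C (c (\<lambda>x. n x * k))" for n k
    by (induction k) (simp_all add: one_Q C_zero c_zero C_add c_closed c_add add.commute)
  have "C (c \<delta>) [^]\<^bsub>Q\<^esub> p = \<one>\<^bsub>Q\<^esub>"
    unfolding pow one_Q by (rule C_M[OF c_multiple])
  ultimately have "p dvd card E"
    using p(1) by (intro Q.prime_dvd_card_subgroup[of E "C (c \<delta>)"]) (auto simp: E_def)
  define \<phi> where "\<phi> g X = (\<lambda>f. single \<one> g \<otimes>\<^bsub>RG\<^esub> f) ` X" for g and X :: "('g \<Rightarrow> 'r) set"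
  have ee: "single \<one> g \<otimes>\<^bsub>RG\<^esub> (single \<one> h \<otimes>\<^bsub>RG\<^esub> f) = single \<one> (g \<otimes>\<^bsub>G\<^esub> h) \<otimes>\<^bsub>RG\<^esub> f"
    if "g \<in> carrier G" "h \<in> carrier G" "f \<in> carrier RG" for g h f
    using that by (simp add: single_closed single_mult_single flip: RG.m_assoc)
  \<comment> \<open>Translating a coset gives a whole coset and not merely a subset of one, because
    \<open>M\<close> is also stable under the inverse of \<open>g\<close>.\<close>
  have \<phi>C: "\<phi> g (C f) = C (single \<one> g \<otimes>\<^bsub>RG\<^esub> f)" if g: "g \<in> carrier G" and f: "f \<in> carrier RG" for g f
  proof (intro subset_antisym subsetI)
    fix x assume "x \<in> \<phi> g (C f)"
    then obtain m where m: "m \<in> M" "x = single \<one> g \<otimes>\<^bsub>RG\<^esub> (m \<oplus>\<^bsub>RG\<^esub> f)"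
      by (auto simp: \<phi>_def C_iff)
    then have "x = single \<one> g \<otimes>\<^bsub>RG\<^esub> m \<oplus>\<^bsub>RG\<^esub> single \<one> g \<otimes>\<^bsub>RG\<^esub> f"
      using f Mc by (simp add: RG.r_distr single_closed)
    then show "x \<in> C (single \<one> g \<otimes>\<^bsub>RG\<^esub> f)"
      using MD(6)[OF single_closed m(1)] C_iff by blast
  next
    fix x assume "x \<in> C (single \<one> g \<otimes>\<^bsub>RG\<^esub> f)"
    then obtain m where m: "m \<in> M" "x = m \<oplus>\<^bsub>RG\<^esub> single \<one> g \<otimes>\<^bsub>RG\<^esub> f"
      using C_iff by blast
    let ?m = "single \<one> (inv\<^bsub>G\<^esub> g) \<otimes>\<^bsub>RG\<^esub> m"
    have "single \<one> g \<otimes>\<^bsub>RG\<^esub> ?m = m"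
      using ee[of g "inv\<^bsub>G\<^esub> g" m] g Mc[OF m(1)] by (simp flip: RG_one)
    then have "x = single \<one> g \<otimes>\<^bsub>RG\<^esub> (?m \<oplus>\<^bsub>RG\<^esub> f)"
      using f m Mc by (simp add: RG.r_distr single_closed)
    moreover have "?m \<in> M"
      using MD(6)[OF single_closed m(1)] by simp
    ultimately show "x \<in> \<phi> g (C f)"
      unfolding \<phi>_def using C_iff by blast
  qed
  \<comment> \<open>A group element only permutes the coefficients, so they stay integral and
    \<open>E\<close> is stable under the action.\<close>
  have ec: "single \<one> g \<otimes>\<^bsub>RG\<^esub> c n = c (\<lambda>x. n (inv\<^bsub>G\<^esub> g \<otimes>\<^bsub>G\<^esub> x))" if "g \<in> carrier G" for g n
    using that c_closed by (intro RG_eqI RG_mult_closed) (auto simp: single_mult single_closed c_apply)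
  interpret act: group_action G E "\<lambda>g. restrict (\<phi> g) E"
  proof (rule G.group_actionI)
    show "\<phi> g X \<in> E" if "g \<in> carrier G" "X \<in> E" for g X
      using that by (auto simp: E_def \<phi>C c_closed ec)
    show "\<phi> \<one>\<^bsub>G\<^esub> X = X" if "X \<in> E" for X
      using that by (auto simp: E_def \<phi>C c_closed simp flip: RG_one)
    show "\<phi> (g \<otimes>\<^bsub>G\<^esub> h) X = \<phi> g (\<phi> h X)" if "g \<in> carrier G" "h \<in> carrier G" "X \<in> E" for g h X
      using that by (auto simp: E_def \<phi>C c_closed single_closed ee)
  qed
  obtain a where "order G = p ^ a"
    using G.p_group_order[OF fin p] by blast
  \<comment> \<open>The zero coset \<open>M\<close> is the known fixed point; the counting argument
    supplies a second one, which is nonzero.\<close>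
  moreover have "restrict (\<phi> g) E M = M" if "g \<in> carrier G" for g
    using that ME \<phi>C[OF that RG.zero_closed] C_zero by (simp add: single_closed)
  ultimately obtain X where X: "X \<in> E" "X \<noteq> M" "\<And>g. g \<in> carrier G \<Longrightarrow> \<phi> g X = X"
    using act.p_group_fixed_point[OF p(1) _ \<open>finite E\<close> \<open>p dvd card E\<close> ME] by (metis restrict_apply)
  obtain n where n: "X = C (c n)"
    using X(1) by (auto simp: E_def)
  have "c n \<notin> M"
    using X(2) C_M n by blast
  moreover have "single \<one> g \<otimes>\<^bsub>RG\<^esub> c n \<ominus>\<^bsub>RG\<^esub> c n \<in> M" if g: "g \<in> carrier G" for g
    using X(3)[OF g] g unfolding n by (simp add: \<phi>C c_closed C_eq single_closed)
  ultimately show ?thesis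
    using c_closed by blast
qed

text \<open>A vector \<open>w\<close> fixed modulo \<open>M\<close> generates everything modulo
  \<open>M\<close>, so \<open>1 = m + x w\<close>. Then \<open>k\<close> is congruent to
  \<open>k x w\<close>, hence to \<open>aug (k x) w\<close>, whose coefficients are radical.\<close>

lemma augmentation_jacobson_finite:
  assumes fin: "finite (carrier G)" and p: "prime p" "p_group p G"
    and pJ: "[p] \<cdot> \<one> \<in> jacobson_radical R"
    and k: "k \<in> carrier RG" "aug k \<in> jacobson_radical R"
  shows "k \<in> jacobson_radical RG"
proof -
  have "k \<in> M" if M: "maximal_left_ideal M RG" for M
  proof -
    note lM = RG.maximal_left_idealD(1)[OF M]
    note MD = RG.left_idealD[OF lM]
    obtain w where w: "w \<in> carrier RG" "w \<notin> M"
      "\<And>g. g \<in> carrier G \<Longrightarrow> single \<one> g \<otimes>\<^bsub>RG\<^esub> w \<ominus>\<^bsub>RG\<^esub> w \<in> M"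
      using fixed_coset_exists[OF fin p pJ M] by blast
    have "w \<in> {x \<otimes>\<^bsub>RG\<^esub> w | x. x \<in> carrier RG}"
      using w(1) by (force intro: exI[of _ "\<one>\<^bsub>RG\<^esub>"])
    then obtain m x where mx: "m \<in> M" "x \<in> carrier RG" "\<one>\<^bsub>RG\<^esub> = m \<oplus>\<^bsub>RG\<^esub> x \<otimes>\<^bsub>RG\<^esub> w"
      using RG.maximal_left_ideal_sum[OF M RG.left_ideal_principal[OF w(1)] _ RG.one_closed] w(2)
      by blast
    have mc: "m \<in> carrier RG"
      using mx(1) MD(1) by blast
    \<comment> \<open>Since each group element fixes \<open>w\<close> modulo \<open>M\<close>, a
      general \<open>y\<close> acts on \<open>w\<close> through its augmentation, term by
      term.\<close>
    have trivial: "y \<otimes>\<^bsub>RG\<^esub> w \<ominus>\<^bsub>RG\<^esub> scale (aug y) w \<in> M" if "y \<in> carrier RG" for y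
      using that
    proof (induction rule: RG_induct)
      case zero
      have "single \<zero> \<one>\<^bsub>G\<^esub> = \<zero>\<^bsub>RG\<^esub>"
        by (intro RG_eqI) (auto simp: single_closed single_apply RG_zero)
      then show ?case
        using w(1) MD(2) by (simp add: RG.minus_eq)
    next
      case (add r g h)
      have ag: "aug (single r g \<oplus>\<^bsub>RG\<^esub> h) = r \<oplus> aug h"
        using add by (simp add: single_closed aug_single)
      have s: "single (r \<oplus> aug h) \<one>\<^bsub>G\<^esub> = single r \<one>\<^bsub>G\<^esub> \<oplus>\<^bsub>RG\<^esub> single (aug h) \<one>\<^bsub>G\<^esub>"
        using add by (intro RG_eqI RG_add_closed) (auto simp: single_closed RG_add single_apply)
      have "single r g = scale r (single \<one> g)"
        using add by (simp add: single_mult_single)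
      then have "single r g \<otimes>\<^bsub>RG\<^esub> w \<ominus>\<^bsub>RG\<^esub> scale r w = scale r (single \<one> g \<otimes>\<^bsub>RG\<^esub> w \<ominus>\<^bsub>RG\<^esub> w)"
        using add w(1) by (simp add: single_closed RG.m_assoc RG.r_distr RG.minus_eq RG.r_minus)
      then have 3: "single r g \<otimes>\<^bsub>RG\<^esub> w \<ominus>\<^bsub>RG\<^esub> scale r w \<in> M"
        using w(3)[of g] add by (auto intro: MD single_closed)
      have "(single r g \<oplus>\<^bsub>RG\<^esub> h) \<otimes>\<^bsub>RG\<^esub> w \<ominus>\<^bsub>RG\<^esub> scale (aug (single r g \<oplus>\<^bsub>RG\<^esub> h)) w =
          (single r g \<otimes>\<^bsub>RG\<^esub> w \<ominus>\<^bsub>RG\<^esub> scale r w) \<oplus>\<^bsub>RG\<^esub> (h \<otimes>\<^bsub>RG\<^esub> w \<ominus>\<^bsub>RG\<^esub> scale (aug h) w)"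
        unfolding ag s using add w(1)
        by (simp add: single_closed RG.l_distr RG.minus_eq RG.minus_add RG.a_ac)
      then show ?case
        using MD(3)[OF 3 add(4)] by simp
    qed
    have kx: "k \<otimes>\<^bsub>RG\<^esub> x \<in> carrier RG"
      using k(1) mx(2) by simp
    have augkx: "aug (k \<otimes>\<^bsub>RG\<^esub> x) \<in> jacobson_radical R"
      using k mx(2) R.jacobson_radical_r_mult by simp
    \<comment> \<open>The radical factor stands to the left of each coefficient of \<open>w\<close>,
      so this uses that the radical is closed under right multiplication.\<close>
    have "scale (aug (k \<otimes>\<^bsub>RG\<^esub> x)) w \<in> radical_coefficients"
      using augkx kx w(1) RG_carrierD(1)[OF w(1)] R.jacobson_radical_r_mult R.jacobson_radicalD(1)
      by (auto simp: radical_coefficients_def scale_apply single_closed)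
    then have "scale (aug (k \<otimes>\<^bsub>RG\<^esub> x)) w \<in> M"
      using radical_coefficients_subset_maximal[OF fin M] by blast
    then have "(k \<otimes>\<^bsub>RG\<^esub> x \<otimes>\<^bsub>RG\<^esub> w \<ominus>\<^bsub>RG\<^esub> scale (aug (k \<otimes>\<^bsub>RG\<^esub> x)) w) \<oplus>\<^bsub>RG\<^esub> scale (aug (k \<otimes>\<^bsub>RG\<^esub> x)) w \<in> M"
      using MD(3)[OF trivial[OF kx]] by blast
    moreover have "(k \<otimes>\<^bsub>RG\<^esub> x \<otimes>\<^bsub>RG\<^esub> w \<ominus>\<^bsub>RG\<^esub> scale (aug (k \<otimes>\<^bsub>RG\<^esub> x)) w) \<oplus>\<^bsub>RG\<^esub> scale (aug (k \<otimes>\<^bsub>RG\<^esub> x)) w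
        = k \<otimes>\<^bsub>RG\<^esub> x \<otimes>\<^bsub>RG\<^esub> w"
      using RG.m_closed[OF kx w(1)] RG.m_closed[OF single_closed w(1)] aug.hom_closed[OF kx]
      by (simp add: RG.minus_eq RG.a_assoc RG.l_neg del: aug.hom_mult)
    ultimately have "k \<otimes>\<^bsub>RG\<^esub> m \<oplus>\<^bsub>RG\<^esub> k \<otimes>\<^bsub>RG\<^esub> x \<otimes>\<^bsub>RG\<^esub> w \<in> M"
      using MD(3)[OF MD(6)[OF k(1) mx(1)]] by simp
    moreover have "k \<otimes>\<^bsub>RG\<^esub> m \<oplus>\<^bsub>RG\<^esub> k \<otimes>\<^bsub>RG\<^esub> x \<otimes>\<^bsub>RG\<^esub> w = k \<otimes>\<^bsub>RG\<^esub> (m \<oplus>\<^bsub>RG\<^esub> x \<otimes>\<^bsub>RG\<^esub> w)"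
      using k(1) mc mx(2) w(1) by (simp add: RG.r_distr RG.m_assoc)
    ultimately show "k \<in> M"
      using k(1) by (simp flip: mx(3))
  qed
  then show ?thesis
    using k(1) by (simp add: jacobson_radical_def)
qed

end

section \<open>Locally finite groups\<close>

lemma (in group) p_group_subgroup:
  assumes "p_group p G" "subgroup H G"
  shows "p_group p (G\<lparr>carrier := H\<rparr>)"
proof -
  interpret H: group "G\<lparr>carrier := H\<rparr>"
    using assms(2) is_group by (rule subgroup.subgroup_is_group)
  have "H.ord x = ord x" if x: "x \<in> H" for x
  proof -
    have xG: "x \<in> carrier G"
      using x subgroup.subset[OF assms(2)] by blast
    have "H.ord x dvd n \<longleftrightarrow> ord x dvd n" for n
      using H.pow_eq_id[of x n] pow_eq_id[OF xG, of n] x by (simp flip: nat_pow_consistent)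
    then show ?thesis
      by (meson dvd_antisym dvd_refl)
  qed
  then show ?thesis
    using assms subgroup.subset[OF assms(2)] by (auto simp: p_group_def)
qed

context ring_and_group
begin

text \<open>Extension by zero respects products and 1, so a left inverse found in the group ring of
  \<open>H\<close> remains one in \<open>RG\<close>. The premise ranges over all \<open>k'\<close>
  with the augmentation of \<open>k\<close>, which spares the statement a restriction map.\<close>

lemma subgroup_ring_left_inverse:
  assumes H: "subgroup H G" and k: "k \<in> carrier RG" "supp k \<subseteq> H"
    and inv: "\<And>k'. k' \<in> carrier (group_ring R (G\<lparr>carrier := H\<rparr>)) \<Longrightarrow>
      ring_and_group.aug R (G\<lparr>carrier := H\<rparr>) k' = aug k \<Longrightarrow>
      \<exists>u \<in> carrier (group_ring R (G\<lparr>carrier := H\<rparr>)).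
        u \<otimes>\<^bsub>group_ring R (G\<lparr>carrier := H\<rparr>)\<^esub>
          (\<one>\<^bsub>group_ring R (G\<lparr>carrier := H\<rparr>)\<^esub> \<ominus>\<^bsub>group_ring R (G\<lparr>carrier := H\<rparr>)\<^esub> k')
        = \<one>\<^bsub>group_ring R (G\<lparr>carrier := H\<rparr>)\<^esub>"
  shows "\<exists>u \<in> carrier RG. u \<otimes>\<^bsub>RG\<^esub> (\<one>\<^bsub>RG\<^esub> \<ominus>\<^bsub>RG\<^esub> k) = \<one>\<^bsub>RG\<^esub>"
proof -
  interpret H: ring_and_group R "G\<lparr>carrier := H\<rparr>"
    using H by (intro ring_and_group.intro R.ring_axioms subgroup.subgroup_is_group G.is_group)
  have HG: "x \<in> carrier G" if "x \<in> H" for x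
    using that subgroup.subset[OF H] by blast
  note Hc = subgroup.one_closed[OF H] subgroup.m_closed[OF H] subgroup.m_inv_closed[OF H]
  have inv_eq: "inv\<^bsub>G\<lparr>carrier := H\<rparr>\<^esub> x = inv\<^bsub>G\<^esub> x" if "x \<in> H" for x
    using G.m_inv_consistent[OF H that] .
  define ext where "ext f = (\<lambda>x \<in> carrier G. if x \<in> H then f x else \<zero>)" for f :: "'g \<Rightarrow> 'r"
  have ext_apply: "ext f x = (if x \<in> H then f x else \<zero>)" if "x \<in> carrier G" for f x
    using that by (simp add: ext_def)
  have supp_ext: "supp (ext f) = H.supp f" for f
    using HG by (auto simp: supp_def H.supp_def ext_def)
  have ext_closed: "ext f \<in> carrier RG" if f: "f \<in> carrier H.RG" for f
    using H.RG_carrierD[OF f] by (intro RG_carrierI) (auto simp: supp_ext, auto simp: ext_def)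
  have ext_mult: "ext (f \<otimes>\<^bsub>H.RG\<^esub> h) = ext f \<otimes>\<^bsub>RG\<^esub> ext h"
    if f: "f \<in> carrier H.RG" and h: "h \<in> carrier H.RG" for f h
  proof (rule RG_eqI)
    fix x assume x: "x \<in> carrier G"
    note fc = H.RG_carrierD[OF f, simplified] and hc = H.RG_carrierD[OF h, simplified]
    have F: "y \<in> H" if "y \<in> H.supp f" for y
      using that H.supp_subset by fastforce
    have eq: "(ext f \<otimes>\<^bsub>RG\<^esub> ext h) x = (\<Oplus>y\<in>H.supp f. ext f y \<otimes> ext h (inv\<^bsub>G\<^esub> y \<otimes>\<^bsub>G\<^esub> x))"
      using F HG fc(3) x by (intro RG_mult_eq ext_closed f h) (auto simp: supp_ext)
    show "ext (f \<otimes>\<^bsub>H.RG\<^esub> h) x = (ext f \<otimes>\<^bsub>RG\<^esub> ext h) x"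
    proof (cases "x \<in> H")
      case True
      have "(f \<otimes>\<^bsub>H.RG\<^esub> h) x = (\<Oplus>y\<in>H.supp f. f y \<otimes> h (inv\<^bsub>G\<lparr>carrier := H\<rparr>\<^esub> y \<otimes>\<^bsub>G\<^esub> x))"
        using True fc(3) H.RG_mult_eq[OF f h _ _ order.refl H.supp_subset, of x] by simp
      also have "\<dots> = (\<Oplus>y\<in>H.supp f. ext f y \<otimes> ext h (inv\<^bsub>G\<^esub> y \<otimes>\<^bsub>G\<^esub> x))"
        using True F HG Hc fc hc by (intro R.finsum_cong') (auto simp: inv_eq ext_apply)
      finally show ?thesis
        using True x eq by (simp add: ext_apply)
    next
      \<comment> \<open>Outside \<open>H\<close> both sides vanish: for \<open>y\<close> in
        \<open>H\<close>, the inverse of \<open>y\<close> times \<open>x\<close> stays outside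
        \<open>H\<close>, where the extension is zero.\<close>
      case False
      have "inv\<^bsub>G\<^esub> y \<otimes>\<^bsub>G\<^esub> x \<notin> H" if y: "y \<in> H" for y
      proof
        assume "inv\<^bsub>G\<^esub> y \<otimes>\<^bsub>G\<^esub> x \<in> H"
        then have "y \<otimes>\<^bsub>G\<^esub> (inv\<^bsub>G\<^esub> y \<otimes>\<^bsub>G\<^esub> x) \<in> H"
          using y Hc by blast
        then show False
          using False HG[OF y] x by (simp flip: G.m_assoc)
      qed
      then have "(\<Oplus>y\<in>H.supp f. ext f y \<otimes> ext h (inv\<^bsub>G\<^esub> y \<otimes>\<^bsub>G\<^esub> x)) = \<zero>"
        using F HG x fc by (intro R.add.finprod_one_eqI) (auto simp: ext_apply)
      then show ?thesis
        using False x eq by (simp add: ext_apply)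
    qed
  qed (use f h in \<open>auto intro: ext_closed RG_mult_closed H.RG_mult_closed\<close>)
  have ext_one: "ext \<one>\<^bsub>H.RG\<^esub> = \<one>\<^bsub>RG\<^esub>"
    using Hc by (intro RG_eqI ext_closed H.RG.one_closed RG.one_closed)
      (auto simp: ext_apply RG_one H.RG_one single_apply H.single_apply)
  define k' where "k' = restrict k H"
  have ext_k': "ext k' = k"
    using k by (auto simp: ext_def k'_def supp_def fun_eq_iff RG_carrierD(2)[OF k(1)])
  have supp_k': "H.supp k' = supp k"
    using supp_ext[of k'] ext_k' by simp
  have k': "k' \<in> carrier H.RG"
    using RG_carrierD[OF k(1)] HG by (intro H.RG_carrierI) (auto simp: supp_k', auto simp: k'_def)
  have "H.aug k' = aug k"
    unfolding H.aug_def aug_def supp_k' using k RG_carrierD(1)[OF k(1)] HG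
    by (intro R.finsum_cong') (auto simp: k'_def)
  then obtain u where u: "u \<in> carrier H.RG" "u \<otimes>\<^bsub>H.RG\<^esub> (\<one>\<^bsub>H.RG\<^esub> \<ominus>\<^bsub>H.RG\<^esub> k') = \<one>\<^bsub>H.RG\<^esub>"
    using inv k' by blast
  have "ext (\<one>\<^bsub>H.RG\<^esub> \<ominus>\<^bsub>H.RG\<^esub> k') = \<one>\<^bsub>RG\<^esub> \<ominus>\<^bsub>RG\<^esub> k"
  proof (rule RG_eqI)
    fix x assume x: "x \<in> carrier G"
    have "k x = ext k' x" "\<one>\<^bsub>RG\<^esub> x = ext \<one>\<^bsub>H.RG\<^esub> x"
      by (simp_all add: ext_k' ext_one)
    then show "ext (\<one>\<^bsub>H.RG\<^esub> \<ominus>\<^bsub>H.RG\<^esub> k') x = (\<one>\<^bsub>RG\<^esub> \<ominus>\<^bsub>RG\<^esub> k) x"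
      using x k(1) k' by (auto simp: ext_apply RG_minus H.RG_minus R.minus_eq)
  qed (use k(1) k' in \<open>auto intro: ext_closed\<close>)
  then have "ext u \<otimes>\<^bsub>RG\<^esub> (\<one>\<^bsub>RG\<^esub> \<ominus>\<^bsub>RG\<^esub> k) = \<one>\<^bsub>RG\<^esub>"
    using ext_mult[OF u(1), of "\<one>\<^bsub>H.RG\<^esub> \<ominus>\<^bsub>H.RG\<^esub> k'"] k' u(2) ext_one by simp
  then show ?thesis
    using ext_closed[OF u(1)] by blast
qed

text \<open>For each \<open>y\<close> the element \<open>y k\<close> lives in the group ring of the
  finite subgroup generated by its support. It is radical there by the finite case, and the
  resulting left inverse is carried up to \<open>RG\<close>; no comparison of the two radicals is
  made.\<close>

lemma augmentation_jacobson:
  assumes lf: "locally_finite_group G" and p: "prime p" "p_group p G"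
    and pJ: "[p] \<cdot> \<one> \<in> jacobson_radical R"
    and k: "k \<in> carrier RG" "aug k \<in> jacobson_radical R"
  shows "k \<in> jacobson_radical RG"
proof (rule RG.mem_jacobson_radicalI[OF k(1)])
  fix y assume y: "y \<in> carrier RG"
  let ?k = "y \<otimes>\<^bsub>RG\<^esub> k"
  let ?H = "generate G (supp ?k)"
  have kc: "?k \<in> carrier RG"
    using y k(1) by simp
  have augk: "aug ?k \<in> jacobson_radical R"
    using y k R.jacobson_radicalD(6) by simp
  have H: "subgroup ?H G"
    using supp_subset by (rule G.generate_is_subgroup)
  have fin: "finite ?H"
    using lf supp_subset RG_carrierD(3)[OF kc] by (simp add: locally_finite_group_def)
  show "\<exists>u \<in> carrier RG. u \<otimes>\<^bsub>RG\<^esub> (\<one>\<^bsub>RG\<^esub> \<ominus>\<^bsub>RG\<^esub> ?k) = \<one>\<^bsub>RG\<^esub>"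
  proof (rule subgroup_ring_left_inverse[OF H kc])
    show "supp ?k \<subseteq> ?H"
      by (auto intro: generate.incl)
    interpret H: ring_and_group R "G\<lparr>carrier := ?H\<rparr>"
      using H by (intro ring_and_group.intro R.ring_axioms subgroup.subgroup_is_group G.is_group)
    fix k' assume k': "k' \<in> carrier H.RG" "H.aug k' = aug ?k"
    have "k' \<in> jacobson_radical H.RG"
      using fin p(1) G.p_group_subgroup[OF p(2) H] pJ k' augk
      by (intro H.augmentation_jacobson_finite[of p]) auto
    then show "\<exists>u \<in> carrier H.RG. u \<otimes>\<^bsub>H.RG\<^esub> (\<one>\<^bsub>H.RG\<^esub> \<ominus>\<^bsub>H.RG\<^esub> k') = \<one>\<^bsub>H.RG\<^esub>"
      by (rule H.RG.one_minus_jacobson_left_inverse)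
  qed
qed

lemma fine_group_ring:
  assumes lf: "locally_finite_group G" and p: "prime p" "p_group p G"
    and pJ: "[p] \<cdot> \<one> \<in> jacobson_radical R" and fine: "generalized_sqrtJ_fine R"
  shows "generalized_sqrtJ_fine RG"
  unfolding generalized_sqrtJ_fine_def
proof
  fix f assume f: "f \<in> carrier RG - jacobson_radical RG"
  note inJ = augmentation_jacobson[OF lf p pJ]
  have "aug f \<in> carrier R - jacobson_radical R"
    using f inJ by auto
  then obtain u a where u: "u \<in> Units R" and a: "a \<in> sqrt_jacobson R" and eq: "aug f = u \<oplus> a"
    using fine unfolding generalized_sqrtJ_fine_def by blast
  obtain m :: nat where ac: "a \<in> carrier R" and m: "m \<ge> 1" "a [^] m \<in> jacobson_radical R"
    using a by (auto simp: sqrt_jacobson_def)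
  have uc: "u \<in> carrier R"
    using u by (rule R.Units_closed)
  \<comment> \<open>The unit is lifted as a constant and \<open>?a\<close> is what remains of
    \<open>f\<close>. Then \<open>aug\<close> sends \<open>?a\<close> to \<open>a\<close>, so the
    power of \<open>a\<close> that is radical in \<open>R\<close> shows that the same power of
    \<open>?a\<close> is radical in \<open>RG\<close>.\<close>
  let ?u = "single u \<one>\<^bsub>G\<^esub>" and ?a = "f \<ominus>\<^bsub>RG\<^esub> single u \<one>\<^bsub>G\<^esub>"
  have c: "?u \<in> carrier RG" "?a \<in> carrier RG"
    using f uc by (auto simp: single_closed)
  have "?u \<in> Units RG"
    using u uc by (intro RG.Units_intro[of _ "single (inv u) \<one>\<^bsub>G\<^esub>" "single (inv u) \<one>\<^bsub>G\<^esub>"])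
      (auto simp: single_closed single_mult_single RG_one)
  moreover have "?a \<in> sqrt_jacobson RG"
  proof -
    have "aug ?a = aug f \<ominus> u"
      using f uc c by (simp add: RG.minus_eq R.minus_eq aug_single)
    also have "\<dots> = a"
      unfolding eq using uc ac by (simp add: R.minus_eq R.a_ac R.r_neg1 R.r_neg2 R.r_neg)
    finally have "aug (?a [^]\<^bsub>RG\<^esub> m) = a [^] m"
      using c(2) by (simp add: aug.hom_nat_pow)
    then have "?a [^]\<^bsub>RG\<^esub> m \<in> jacobson_radical RG"
      using m(2) c(2) by (intro inJ) auto
    then show ?thesis
      using m(1) c(2) by (auto simp: sqrt_jacobson_def)
  qed
  moreover have "f = ?u \<oplus>\<^bsub>RG\<^esub> ?a"
    using f c(1) by (simp add: RG.minus_eq RG.a_ac RG.r_neg1 RG.r_neg2 RG.r_neg)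
  ultimately show "\<exists>u \<in> Units RG. \<exists>a \<in> sqrt_jacobson RG. f = u \<oplus>\<^bsub>RG\<^esub> a"
    by blast
qed

end

text \<open>Two degenerate cases account for the guards in the first part. Over the zero ring
  \<open>RG\<close> is zero, hence fine, for every group. For trivial \<open>G\<close> the ring
  \<open>RG\<close> is a copy of \<open>R\<close>, which may be a field of characteristic zero with
  no prime in its radical.\<close>

theorem theorem3p10:
  fixes R :: "('r, 'm) ring_scheme" and G :: "('g, 'n) monoid_scheme"
  assumes "ring R" and "group G"
  shows "(generalized_sqrtJ_fine (group_ring R G) \<longrightarrow>
            generalized_sqrtJ_fine R \<and>
            (\<one>\<^bsub>R\<^esub> \<noteq> \<zero>\<^bsub>R\<^esub> \<longrightarrow>
              (\<exists>p::nat. prime p \<and> p_group p G \<and>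
                 (carrier G \<noteq> {\<one>\<^bsub>G\<^esub>} \<longrightarrow> [p] \<cdot>\<^bsub>R\<^esub> \<one>\<^bsub>R\<^esub> \<in> jacobson_radical R))))
       \<and> (locally_finite_group G \<and> generalized_sqrtJ_fine R \<and>
            (\<exists>p::nat. prime p \<and> p_group p G \<and> [p] \<cdot>\<^bsub>R\<^esub> \<one>\<^bsub>R\<^esub> \<in> jacobson_radical R) \<longrightarrow>
          generalized_sqrtJ_fine (group_ring R G))"
proof -
  interpret ring_and_group R G
    using assms by (rule ring_and_group.intro)
  show ?thesis
    using aug.generalized_sqrtJ_fine_image[OF aug_surj] p_group_of_fine fine_group_ring by blast
qed

end
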